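(* Assume that $u\in H^1_+\cap L^2_s$ for some $s>\frac12$. Then for every $k\in\mathbb{C}^+\cup\mathbb{C}^-\cup\big((-\infty,0)\setminus\sigma_{pp}(\mathbb{L}_u)\big)$ there exists a unique solution $\phi\in L^\infty_{-s}$ of $$\phi=1+G_k*\big(u\,\Pi(\overline u\phi)\big),$$ and this solution is given by $\phi\equiv1$.
   Context: All functions are complex valued on $\mathbb{R}$. $\hat f(\xi)=\int_{\mathbb{R}} f(x)e^{-ix\xi}\,dx$. $H^\sigma_+=\{f\in H^\sigma(\mathbb{R};\mathbb{C}):\mathrm{supp}\,\hat f\subset[0,+\infty)\}$ for $\sigma\ge0$, $L^2_+=H^0_+$. $\Pi:L^2\to L^2$ is the Cauchy-Szegő projector, $\widehat{\Pi f}(\xi)=\mathbf{1}_{\xi\ge0}\hat f(\xi)$. $L^2_s=\{f:\int_{\mathbb{R}}|f(x)|^2(1+x^2)^s\,dx<\infty\}$, $L^\infty_{-s}=\{f:\|(1+x^2)^{-s/2}f\|_{L^\infty}<\infty\}$. $\mathbb{C}^\pm=\{z:\pm\mathrm{Im}\,z>0\}$. For $k\in\mathbb{C}\setminus[0,+\infty)$, $G_k\in L^2$ is the inverse Fourier transform of $\xi\mapsto\mathbf{1}_{\xi\ge0}/(\xi-k)$, i.e. $G_k(x)=\frac1{2\pi}\int_0^\infty\frac{e^{ix\xi}}{\xi-k}\,d\xi$. $\mathbb{L}_uh=-i\partial_xh-u\Pi(\overline uh)$ is the self-adjoint Lax operator on $L^2_+$ with domain $H^1_+$, and $\sigma_{pp}(\mathbb{L}_u)$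 is its set of eigenvalues. *)

theory Defs
  imports "HOL-Analysis.Analysis"
begin

text \<open>
  Elements of the function spaces below are represented by Borel functions, and equality of
  elements is equality almost everywhere with respect to Lebesgue measure.
\<close>

definition L2 :: "(real \<Rightarrow> complex) set" where
  "L2 = {f \<in> borel_measurable lborel. integrable lborel (\<lambda>x. (cmod (f x))\<^sup>2)}"

definition L2_weighted :: "real \<Rightarrow> (real \<Rightarrow> complex) set" where
  "L2_weighted s =
     {f \<in> borel_measurable lborel. integrable lborel (\<lambda>x. (cmod (f x))\<^sup>2 * (1 + x\<^sup>2) powr s)}"

text \<open>The parameter is the weight exponent, so that the weight is \<open>(1 + x\<^sup>2)\<^bsup>r/2\<^esup>\<close>.\<close>

definition Linf_weighted :: "real \<Rightarrow> (real \<Rightarrow> complex) set" where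
  "Linf_weighted r =
     {f \<in> borel_measurable lborel. \<exists>C. AE x in lborel. cmod ((1 + x\<^sup>2) powr (r / 2) * f x) \<le> C}"

definition fourier_trunc :: "real \<Rightarrow> (real \<Rightarrow> complex) \<Rightarrow> real \<Rightarrow> complex" where
  "fourier_trunc R f \<xi> = (LINT x:{-R..R}|lborel. f x * exp (- (\<i> * of_real (x * \<xi>))))"

text \<open>
  The Fourier transform on \<open>L2\<close>: the limit in mean square, as \<open>R \<rightarrow> \<infinity>\<close>, of the integrals over
  \<open>[-R, R]\<close>. The distance is a nonnegative integral with values in the extended reals, so
  the condition is not met by default when a difference fails to be square integrable.
  The choice operator picks a representative of the limit class.
\<close>

definition fourier :: "(real \<Rightarrow> complex) \<Rightarrow> real \<Rightarrow> complex" where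
  "fourier f = (SOME g. g \<in> L2 \<and>
     ((\<lambda>R. \<integral>\<^sup>+ \<xi>. ennreal ((cmod (g \<xi> - fourier_trunc R f \<xi>))\<^sup>2) \<partial>lborel) \<longlongrightarrow> 0) at_top)"

definition inv_fourier :: "(real \<Rightarrow> complex) \<Rightarrow> real \<Rightarrow> complex" where
  "inv_fourier g x = 1 / (2 * of_real pi) * fourier g (- x)"

text \<open>Support of a function as a distribution: complement of the largest open null set.\<close>

definition ess_support :: "(real \<Rightarrow> complex) \<Rightarrow> real set" where
  "ess_support f = - \<Union>{U. open U \<and> (AE x in lborel. x \<in> U \<longrightarrow> f x = 0)}"

definition H_space :: "real \<Rightarrow> (real \<Rightarrow> complex) set" where
  "H_space \<sigma> = {f \<in> L2. integrable lborel (\<lambda>\<xi>. (1 + \<xi>\<^sup>2) powr \<sigma> * (cmod (fourier f \<xi>))\<^sup>2)}"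

definition H_plus :: "real \<Rightarrow> (real \<Rightarrow> complex) set" where
  "H_plus \<sigma> = {f \<in> H_space \<sigma>. ess_support (fourier f) \<subseteq> {0..}}"

definition szego :: "(real \<Rightarrow> complex) \<Rightarrow> real \<Rightarrow> complex" where
  "szego f = inv_fourier (\<lambda>\<xi>. of_real (indicator {0..} \<xi>) * fourier f \<xi>)"

definition G :: "complex \<Rightarrow> real \<Rightarrow> complex" where
  "G k = inv_fourier (\<lambda>\<xi>. of_real (indicator {0..} \<xi>) / (of_real \<xi> - k))"

definition convolution :: "(real \<Rightarrow> complex) \<Rightarrow> (real \<Rightarrow> complex) \<Rightarrow> real \<Rightarrow> complex" where
  "convolution f g x = (LINT y|lborel. f (x - y) * g y)"

text \<open>The distributional derivative of an element of \<open>H_space 1\<close>.\<close>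

definition deriv_L2 :: "(real \<Rightarrow> complex) \<Rightarrow> real \<Rightarrow> complex" where
  "deriv_L2 h = inv_fourier (\<lambda>\<xi>. \<i> * of_real \<xi> * fourier h \<xi>)"

definition lax :: "(real \<Rightarrow> complex) \<Rightarrow> (real \<Rightarrow> complex) \<Rightarrow> real \<Rightarrow> complex" where
  "lax u h x = - \<i> * deriv_L2 h x - u x * szego (\<lambda>y. cnj (u y) * h y) x"

text \<open>Eigenvalues of the operator \<open>lax u\<close> with domain \<open>H_plus 1\<close>.\<close>

definition sigma_pp :: "(real \<Rightarrow> complex) \<Rightarrow> complex set" where
  "sigma_pp u = {\<mu>. \<exists>h \<in> H_plus 1. \<not> (AE x in lborel. h x = 0) \<and>
                      (AE x in lborel. lax u h x = \<mu> * h x)}"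

definition is_solution ::
  "(real \<Rightarrow> complex) \<Rightarrow> real \<Rightarrow> complex \<Rightarrow> (real \<Rightarrow> complex) \<Rightarrow> bool" where
  "is_solution u s k \<phi> \<longleftrightarrow> \<phi> \<in> Linf_weighted (- s) \<and>
     (AE x in lborel. \<phi> x =
        1 + convolution (G k) (\<lambda>y. u y * szego (\<lambda>z. cnj (u z) * \<phi> z) y) x)"

end

theory Submission
  imports Defs "HOL-Probability.Characteristic_Functions" "HOL-Probability.Sinc_Integral"
begin

text \<open>
  Since \<open>u\<close> has spectrum in \<open>[0, \<infinity>)\<close>, its conjugate is annihilated by the projector, so \<open>1\<close> is a
  solution. If \<open>\<phi>\<close> is any solution, then \<open>w = \<phi> - 1\<close> equals \<open>G k * (u \<Pi>(cnj u w))\<close>. On the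
  Fourier side this reads \<open>(\<xi> - k) w^ = (u \<Pi>(cnj u w))^\<close>, because a product of two functions with
  spectrum in \<open>[0, \<infinity>)\<close> has spectrum in \<open>[0, \<infinity>)\<close>; hence \<open>w\<close> lies in the domain of the Lax operator
  and is an eigenfunction for \<open>k\<close> unless it vanishes. The Lax operator is symmetric, so a non-real
  \<open>k\<close> is no eigenvalue.

  The Fourier transform on \<open>L2\<close> rests on the regularised identity that the transform of
  \<open>gauss e \<cdot> f^\<close> is a Gaussian average of \<open>f\<close>. Together with Schur's test it bounds the transform
  on \<open>L2\<close>; tested against intervals it yields the inversion formula. Convolutions and products
  are then handled with the multiplication formula alone.
\<close>

section \<open>The Fourier integral and Gaussian regularisation\<close>

text \<open>A solution is only assumed to lie in a weighted L^\<infinity> space, so neither it nor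
  \<phi> - 1 has a Fourier transform to begin with. What can be transformed is
  \<open>cnj u * \<phi>\<close>: the two weights cancel and leave a function in \<open>L2\<close>.
  The symbol 1/(\<xi> - k) is bounded and square integrable on the half line because k has positive
  distance from [0, \<infinity>), and u is bounded because it lies in H^1. So the right-hand side of
  the equation is 1 plus an \<open>L2\<close> function, and w inherits its integrability from the
  equation. The same equation supplies the derivative: \<xi> w^ = k w^ + f^ with f = u \<Pi>(cnj u
  \<phi>) exhibits \<xi> w^ as a sum of \<open>L2\<close> functions, which is the regularity that an
  eigenfunction must have.

  The transform is a choice among limits that agree almost everywhere. Linear rules therefore hold
  almost everywhere, whereas changing the argument on a null set leaves the transform literally
  unchanged; both kinds of equality occur below. The kernel carries no normalising factor, whence
  the constants 2 pi.\<close>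

definition ft :: "(real \<Rightarrow> complex) \<Rightarrow> real \<Rightarrow> complex" where
  "ft f \<xi> = (LINT x|lborel. f x * exp (- (\<i> * of_real (x * \<xi>))))"

lemma borel_measurable_cnj [measurable]: "cnj \<in> borel_measurable borel"
  by (intro borel_measurable_continuous_onI continuous_intros)

lemma norm_exp_minus_ii [simp]: "cmod (exp (- (\<i> * of_real x))) = 1"
  by (simp add: norm_exp_eq_Re)

text \<open>Stated beside the previous rule because simplification distributes
  \<open>of_real\<close> over the product in the phase.\<close>

lemma norm_exp_minus_ii_mult [simp]: "cmod (exp (- (\<i> * (of_real x * of_real y)))) = 1"
  by (simp add: norm_exp_eq_Re)

lemma integrable_ft:
  assumes "integrable lborel f"
  shows "integrable lborel (\<lambda>x. f x * exp (- (\<i> * of_real (x * \<xi>))))"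
  by (rule Bochner_Integration.integrable_bound[OF integrable_norm[OF assms]])
     (use assms in \<open>auto simp: norm_mult\<close>)

lemma borel_measurable_ft [measurable]:
  assumes [measurable]: "f \<in> borel_measurable lborel"
  shows "ft f \<in> borel_measurable lborel"
  unfolding ft_def by measurable

lemma norm_ft_le:
  assumes "integrable lborel f"
  shows "cmod (ft f \<xi>) \<le> (LINT x|lborel. cmod (f x))"
  unfolding ft_def
  using integral_norm_bound[of lborel "\<lambda>x. f x * exp (- (\<i> * of_real (x * \<xi>)))"]
  by (simp add: norm_mult)

text \<open>The kernel has modulus |f x| |g \<xi>|, so Fubini applies. Later identities for
  products, convolutions and inner products come from moving a transform from one factor to the
  other.\<close>

lemma ft_multiplication_formula:
  assumes f: "integrable lborel f" and g: "integrable lborel g"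
  shows "(LINT \<xi>|lborel. ft f \<xi> * g \<xi>) = (LINT x|lborel. f x * ft g x)"
proof -
  have [measurable]: "f \<in> borel_measurable borel" "g \<in> borel_measurable borel"
    using f g by auto
  have "integrable (lborel \<Otimes>\<^sub>M lborel) (case_prod (\<lambda>x \<xi>. f x * exp (- (\<i> * of_real (x * \<xi>))) * g \<xi>))"
  proof (rule lborel_pair.Fubini_integrable)
    show "AE x in lborel. integrable lborel
       (\<lambda>y. case (x, y) of (x, \<xi>) \<Rightarrow> f x * exp (- (\<i> * of_real (x * \<xi>))) * g \<xi>)"
    proof (rule AE_I2)
      fix x :: real
      show "integrable lborel
       (\<lambda>y. case (x, y) of (x, \<xi>) \<Rightarrow> f x * exp (- (\<i> * of_real (x * \<xi>))) * g \<xi>)"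
        using integrable_mult_right[OF integrable_ft[OF g, of x], of "f x"]
        by (simp add: mult_ac)
    qed
    have "(\<lambda>x. \<integral> y. norm (case (x, y) of (x, \<xi>) \<Rightarrow> f x * exp (- (\<i> * of_real (x * \<xi>))) * g \<xi>) \<partial>lborel)
        = (\<lambda>x. norm (f x) * (\<integral>y. norm (g y) \<partial>lborel))"
      by (simp add: norm_mult)
    then show "integrable lborel (\<lambda>x. \<integral> y. norm (case (x, y) of (x, \<xi>) \<Rightarrow>
        f x * exp (- (\<i> * of_real (x * \<xi>))) * g \<xi>) \<partial>lborel)"
      using f by simp
  qed measurable
  from lborel_pair.Fubini_integral[OF this]
  have "(LINT \<xi>|lborel. (LINT x|lborel. f x * exp (- (\<i> * of_real (x * \<xi>)))* g \<xi>)) =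
        (LINT x|lborel. (LINT \<xi>|lborel. f x * exp (- (\<i> * of_real (x * \<xi>))) * g \<xi>))" .
  also have "(\<lambda>x. LINT \<xi>|lborel. f x * exp (- (\<i> * of_real (x * \<xi>))) * g \<xi>) = (\<lambda>x. f x * ft g x)"
    unfolding ft_def by (simp add: mult_ac flip: integral_mult_right_zero)
  also have "(\<lambda>\<xi>. LINT x|lborel. f x * exp (- (\<i> * of_real (x * \<xi>))) * g \<xi>) = (\<lambda>\<xi>. ft f \<xi> * g \<xi>)"
    unfolding ft_def by simp
  finally show ?thesis .
qed

section \<open>Gaussians and their transforms\<close>

definition gauss :: "real \<Rightarrow> real \<Rightarrow> real" where
  "gauss e \<xi> = exp (- (e * \<xi>)\<^sup>2 / 2)"

lemma gauss_bounds: "0 < gauss e \<xi>" "gauss e \<xi> \<le> 1"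
  by (auto simp: gauss_def)

lemma borel_measurable_gauss [measurable]: "gauss e \<in> borel_measurable borel"
  unfolding gauss_def by measurable

text \<open>The summand 0 puts the argument into the form \<open>t + c * x\<close> of the affine
  change of variables on \<open>lborel\<close>.\<close>

lemma gauss_eq_normal_density: "gauss e \<xi> = sqrt (2 * pi) * std_normal_density (0 + e * \<xi>)"
  by (simp add: gauss_def std_normal_density_def)

lemma integrable_gauss:
  assumes "e \<noteq> 0"
  shows "integrable lborel (gauss e)"
proof -
  have "integrable lborel (\<lambda>\<xi>. sqrt (2 * pi) * std_normal_density (0 + e * \<xi>))"
    by (rule integrable_mult_right, rule lborel_integrable_real_affine) (use assms in auto)
  then show ?thesis
    by (simp add: gauss_eq_normal_density[abs_def])
qed

text \<open>After scaling, this is the characteristic function of the standard normal law. The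
  result is 2 pi times a density of mass one and standard deviation e, hence an approximate identity
  as e tends to 0.\<close>

lemma ft_gauss:
  assumes "e > 0"
  shows "ft (\<lambda>\<xi>. of_real (gauss e \<xi>)) y = of_real (2 * pi * normal_density 0 e y)"
proof -
  \<comment> \<open>In the variable t = e * \<xi> the phase -\<xi> * y becomes
    \<open>?s * t\<close>.\<close>
  let ?s = "- y / e"
  have "ft (\<lambda>\<xi>. of_real (gauss e \<xi>)) y =
      (LINT \<xi>|lborel. sqrt (2 * pi) * (of_real (std_normal_density (0 + e * \<xi>)) * iexp (?s * (0 + e * \<xi>))))"
    unfolding ft_def gauss_eq_normal_density
    by (intro Bochner_Integration.integral_cong) (use assms in \<open>auto simp: mult_ac\<close>)
  also have "\<dots> = sqrt (2 * pi) * (LINT \<xi>|lborel. (of_real (std_normal_density (0 + e * \<xi>)) * iexp (?s * (0 + e * \<xi>))))"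
    by (rule integral_mult_right_zero)
  also have "(LINT \<xi>|lborel. (of_real (std_normal_density (0 + e * \<xi>)) * iexp (?s * (0 + e * \<xi>)))) =
     (LINT t|lborel. of_real (std_normal_density t) * iexp (?s * t)) / e"
    using lborel_integral_real_affine[of e "\<lambda>t. of_real (std_normal_density t) * iexp (?s * t)" 0] assms
    by (simp add: scaleR_conv_of_real)
  also have "(LINT t|lborel. of_real (std_normal_density t) * iexp (?s * t)) = char std_normal_distribution ?s"
    unfolding char_def by (subst integral_density) (auto simp: scaleR_conv_of_real)
  also have "\<dots> = of_real (exp (- (?s\<^sup>2) / 2))"
    by (simp add: char_std_normal_distribution)
  also have "sqrt (2 * pi) * (complex_of_real (exp (- (?s\<^sup>2) / 2)) / e) =
      of_real (sqrt (2 * pi) / e * exp (- (?s\<^sup>2) / 2))"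
    by simp
  also have "sqrt (2 * pi) / e * exp (- (?s\<^sup>2) / 2) = 2 * pi * normal_density 0 e y"
  proof -
    have "2 * pi * (1 / sqrt (2 * pi * e\<^sup>2)) = sqrt (2 * pi) / e"
      using assms by (simp add: real_sqrt_mult field_simps flip: power2_eq_square)
    then show ?thesis
      using assms by (simp add: normal_density_def power_divide mult.commute[of "e\<^sup>2"] field_simps)
  qed
  finally show ?thesis .
qed

lemma ft_gauss_shift:
  assumes "e > 0"
  shows "ft (\<lambda>\<xi>. of_real (gauss e \<xi>) * exp (- (\<i> * of_real (\<xi> * x)))) y = of_real (2 * pi * normal_density 0 e (x + y))"
  unfolding ft_gauss[OF assms, symmetric] unfolding ft_def
  by (intro Bochner_Integration.integral_cong) (auto simp: algebra_simps simp flip: exp_add)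

text \<open>The multiplication formula with a modulated Gaussian as second factor. Two forward
  transforms compose to a reflection, hence a kernel in x + y instead of x - y.\<close>

lemma ft_gauss_mult_ft:
  fixes f :: "real \<Rightarrow> complex"
  assumes f: "integrable lborel f" and e: "e > 0"
  shows "ft (\<lambda>\<xi>. of_real (gauss e \<xi>) * ft f \<xi>) x = 2 * pi * (LINT y|lborel. f y * of_real (normal_density 0 e (x + y)))"
proof -
  have "ft (\<lambda>\<xi>. of_real (gauss e \<xi>) * ft f \<xi>) x =
     (LINT \<xi>|lborel. ft f \<xi> * (of_real (gauss e \<xi>) * exp (- (\<i> * of_real (\<xi> * x)))))"
    unfolding ft_def[of "\<lambda>\<xi>. of_real (gauss e \<xi>) * ft f \<xi>"] by (simp add: mult_ac)
  also have "\<dots> = (LINT y|lborel. f y * of_real (2 * pi * normal_density 0 e (x + y)))"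
    using e by (subst ft_multiplication_formula[OF f])
      (auto intro!: integrable_ft integrable_of_real integrable_gauss simp: ft_gauss_shift simp del: of_real_mult)
  also have "\<dots> = (LINT y|lborel. 2 * pi * (f y * of_real (normal_density 0 e (x + y))))"
    by (simp add: mult_ac)
  also have "\<dots> = 2 * pi * (LINT y|lborel. f y * of_real (normal_density 0 e (x + y)))"
    by (rule integral_mult_right_zero)
  finally show ?thesis .
qed

section \<open>The mean square bound for the Fourier integral\<close>

definition sqnorm :: "(real \<Rightarrow> complex) \<Rightarrow> ennreal" where
  "sqnorm f = (\<integral>\<^sup>+x. ennreal ((cmod (f x))\<^sup>2) \<partial>lborel)"

lemma ft_cnj: "ft (\<lambda>x. cnj (f x)) \<xi> = cnj (ft f (- \<xi>))"
proof -
  have "cnj (ft f (- \<xi>)) = (LINT x|lborel. cnj (f x * exp (- (\<i> * of_real (x * - \<xi>)))))"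
    unfolding ft_def by (rule Bochner_Integration.integral_cnj[symmetric])
  then show ?thesis
    by (simp add: ft_def exp_cnj del: Bochner_Integration.integral_cnj)
qed

lemma nn_integral_normal_density_shift:
  assumes "e > 0"
  shows "(\<integral>\<^sup>+y. ennreal (normal_density 0 e (y - x)) \<partial>lborel) = 1"
    "(\<integral>\<^sup>+x. ennreal (normal_density 0 e (y - x)) \<partial>lborel) = 1"
proof -
  have 1: "(\<integral>\<^sup>+y. ennreal (normal_density 0 e y) \<partial>lborel) = 1"
    using assms by (subst nn_integral_eq_integral) auto
  show "(\<integral>\<^sup>+y. ennreal (normal_density 0 e (y - x)) \<partial>lborel) = 1"
    using nn_integral_real_affine[of "\<lambda>y. ennreal (normal_density 0 e y)" 1 "- x"] 1
    by (simp add: add.commute)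
  show "(\<integral>\<^sup>+x. ennreal (normal_density 0 e (y - x)) \<partial>lborel) = 1"
    using nn_integral_real_affine[of "\<lambda>y. ennreal (normal_density 0 e y)" "-1" y] 1
    by simp
qed

text \<open>Schur's test for the Gaussian kernel, which has unit mass in each variable.\<close>

lemma nn_integral_gauss_kernel_le:
  assumes [measurable]: "f \<in> borel_measurable borel" and e: "e > 0"
  shows "(\<integral>\<^sup>+x. (\<integral>\<^sup>+y. ennreal (cmod (f x) * cmod (f y) * normal_density 0 e (y - x)) \<partial>lborel) \<partial>lborel)
    \<le> sqnorm f"
proof -
  let ?g = "\<lambda>z. normal_density 0 e z" and ?h = "\<lambda>x. ennreal ((cmod (f x))\<^sup>2)"
  have "(\<integral>\<^sup>+x. (\<integral>\<^sup>+y. ennreal (cmod (f x) * cmod (f y) * ?g (y - x)) \<partial>lborel) \<partial>lborel) \<le>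
    (\<integral>\<^sup>+x. (\<integral>\<^sup>+y. ennreal (1/2) * (?h x * ?g (y - x)) + ennreal (1/2) * (?h y * ?g (y - x)) \<partial>lborel) \<partial>lborel)"
  proof (intro nn_integral_mono)
    fix x y :: real
    have "cmod (f x) * cmod (f y) \<le> 1/2 * (cmod (f x))\<^sup>2 + 1/2 * (cmod (f y))\<^sup>2"
      using sum_squares_bound[of "cmod (f x)" "cmod (f y)"] by simp
    from mult_right_mono[OF this, of "?g (y - x)"]
    have "ennreal (cmod (f x) * cmod (f y) * ?g (y - x)) \<le>
        ennreal (1/2 * ((cmod (f x))\<^sup>2 * ?g (y - x)) + 1/2 * ((cmod (f y))\<^sup>2 * ?g (y - x)))"
      by (intro ennreal_leI) (simp add: algebra_simps)
    also have "\<dots> = ennreal (1/2) * (?h x * ?g (y - x)) + ennreal (1/2) * (?h y * ?g (y - x))"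
      by (simp only: ennreal_plus ennreal_mult normal_density_nonneg zero_le_power2 mult_nonneg_nonneg zero_le_divide_1_iff zero_le_numeral)
    finally show "ennreal (cmod (f x) * cmod (f y) * ?g (y - x)) \<le>
      ennreal (1/2) * (?h x * ?g (y - x)) + ennreal (1/2) * (?h y * ?g (y - x))" .
  qed
  also have "\<dots> = ennreal (1/2) * (\<integral>\<^sup>+x. (\<integral>\<^sup>+y. ?h x * ?g (y - x) \<partial>lborel) \<partial>lborel) +
      ennreal (1/2) * (\<integral>\<^sup>+x. (\<integral>\<^sup>+y. ?h y * ?g (y - x) \<partial>lborel) \<partial>lborel)"
    by (simp add: nn_integral_add nn_integral_cmult)
  also have "(\<integral>\<^sup>+x. (\<integral>\<^sup>+y. ?h y * ?g (y - x) \<partial>lborel) \<partial>lborel) = (\<integral>\<^sup>+y. (\<integral>\<^sup>+x. ?h y * ?g (y - x) \<partial>lborel) \<partial>lborel)"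
    by (rule lborel_pair.Fubini') simp
  also have "\<dots> = sqnorm f"
    by (simp add: nn_integral_cmult nn_integral_normal_density_shift[OF e] sqnorm_def)
  also have "(\<integral>\<^sup>+x. (\<integral>\<^sup>+y. ?h x * ?g (y - x) \<partial>lborel) \<partial>lborel) = sqnorm f"
    by (simp add: nn_integral_cmult nn_integral_normal_density_shift[OF e] sqnorm_def)
  also have "ennreal (1/2) * sqnorm f + ennreal (1/2) * sqnorm f = sqnorm f"
    by (subst distrib_right[symmetric], subst ennreal_plus[symmetric]) auto
  finally show ?thesis .
qed

text \<open>Pairing \<open>ft f\<close> with W, the conjugate of the damped transform, gives the
  left side. The multiplication formula turns this into an integral of f against a Gaussian average
  of its conjugate, which Schur's test bounds. The damping makes W integrable before
  \<open>ft f\<close> is known to be square integrable.\<close>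

lemma sqnorm_ft_gauss_le:
  assumes f: "integrable lborel f" and e: "e > 0"
  shows "(\<integral>\<^sup>+\<xi>. ennreal (gauss e \<xi> * (cmod (ft f \<xi>))\<^sup>2) \<partial>lborel) \<le> ennreal (2 * pi) * sqnorm f"
proof -
  have [measurable]: "f \<in> borel_measurable borel"
    using f by auto
  define B where "B = (LINT x|lborel. cmod (f x))"
  have B: "cmod (ft f \<xi>) \<le> B" for \<xi>
    using norm_ft_le[OF f] by (simp add: B_def)
  define W where "W = (\<lambda>\<xi>. cnj (of_real (gauss e \<xi>) * ft f \<xi>))"
  have W: "integrable lborel W"
  proof (rule Bochner_Integration.integrable_bound)
    show "integrable lborel (\<lambda>\<xi>. B * gauss e \<xi>)"
      using e by (auto intro!: integrable_mult_right integrable_gauss)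
    show "W \<in> borel_measurable lborel"
      unfolding W_def by measurable
    show "AE \<xi> in lborel. norm (W \<xi>) \<le> norm (B * gauss e \<xi>)"
      using B gauss_bounds(1)[of e]
      by (auto simp: W_def norm_mult abs_mult mult.commute less_imp_le intro!: mult_right_mono order_trans[OF _ abs_ge_self])
  qed
  \<comment> \<open>Conjugation reflects the argument, so the kernel is now a function of the
    difference y - x, as in Schur's test.\<close>
  have ftW: "ft W x = cnj (2 * pi * (LINT y|lborel. f y * of_real (normal_density 0 e (y - x))))" for x
    unfolding W_def ft_cnj ft_gauss_mult_ft[OF f e] by (simp add: algebra_simps)
  have int_f: "integrable lborel (\<lambda>y. f y * of_real (normal_density 0 e (y - x)))" for x
  proof (rule Bochner_Integration.integrable_bound)
    show "integrable lborel (\<lambda>x. 1 / sqrt (2 * pi * e\<^sup>2) * norm (f x))"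
      using f by simp
    show "AE y in lborel. norm (f y * of_real (normal_density 0 e (y - x))) \<le> norm (1 / sqrt (2 * pi * e\<^sup>2) * norm (f y))"
    proof (rule AE_I2)
      fix y
      have "normal_density 0 e (y - x) \<le> 1 / sqrt (2 * pi * e\<^sup>2)"
        unfolding normal_density_def by (rule mult_left_le) auto
      from mult_right_mono[OF this, of "cmod (f y)"]
      show "norm (f y * of_real (normal_density 0 e (y - x))) \<le> norm (1 / sqrt (2 * pi * e\<^sup>2) * norm (f y))"
        by (simp add: norm_mult mult.commute)
    qed
  qed measurable
  have normW: "ennreal (cmod (ft W x)) \<le> ennreal (2 * pi) * (\<integral>\<^sup>+y. ennreal (cmod (f y) * normal_density 0 e (y - x)) \<partial>lborel)" for x
  proof -
    have "ennreal (cmod (ft W x)) = ennreal (2 * pi) * ennreal (cmod (LINT y|lborel. f y * of_real (normal_density 0 e (y - x))))"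
      by (simp add: ftW norm_mult ennreal_mult)
    also have "\<dots> \<le> ennreal (2 * pi) * (\<integral>\<^sup>+y. ennreal (cmod (f y * of_real (normal_density 0 e (y - x)))) \<partial>lborel)"
      by (intro mult_left_mono integral_norm_bound_ennreal int_f) auto
    finally show ?thesis
      by (simp add: norm_mult)
  qed
  have int_fW: "integrable lborel (\<lambda>x. f x * ft W x)"
  proof (rule Bochner_Integration.integrable_bound)
    show "integrable lborel (\<lambda>x. (LINT \<xi>|lborel. cmod (W \<xi>)) * cmod (f x))"
      using f by simp
    show "(\<lambda>x. f x * ft W x) \<in> borel_measurable lborel"
      using W by measurable
    show "AE x in lborel. norm (f x * ft W x) \<le> norm ((LINT \<xi>|lborel. cmod (W \<xi>)) * cmod (f x))"
      using norm_ft_le[OF W]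
      by (auto simp: norm_mult mult.commute intro!: mult_left_mono order_trans[OF _ abs_ge_self])
  qed
  have int_g: "integrable lborel (\<lambda>\<xi>. gauss e \<xi> * (cmod (ft f \<xi>))\<^sup>2)"
  proof (rule Bochner_Integration.integrable_bound)
    show "integrable lborel (\<lambda>\<xi>. B\<^sup>2 * gauss e \<xi>)"
      using e by (auto intro!: integrable_mult_right integrable_gauss)
    show "AE \<xi> in lborel. norm (gauss e \<xi> * (cmod (ft f \<xi>))\<^sup>2) \<le> norm (B\<^sup>2 * gauss e \<xi>)"
      using B gauss_bounds(1)[of e]
      by (auto simp: abs_mult mult.commute less_imp_le intro!: mult_right_mono power_mono)
  qed measurable
  have "complex_of_real (LINT \<xi>|lborel. gauss e \<xi> * (cmod (ft f \<xi>))\<^sup>2) = (LINT \<xi>|lborel. ft f \<xi> * W \<xi>)"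
    unfolding Bochner_Integration.integral_complex_of_real[symmetric] W_def
    by (intro Bochner_Integration.integral_cong) (auto simp: complex_norm_square[unfolded of_real_power] mult_ac)
  also have "\<dots> = (LINT x|lborel. f x * ft W x)"
    by (rule ft_multiplication_formula[OF f W])
  finally have eq: "complex_of_real (LINT \<xi>|lborel. gauss e \<xi> * (cmod (ft f \<xi>))\<^sup>2) = (LINT x|lborel. f x * ft W x)" .
  have "(\<integral>\<^sup>+\<xi>. ennreal (gauss e \<xi> * (cmod (ft f \<xi>))\<^sup>2) \<partial>lborel) = ennreal (LINT \<xi>|lborel. gauss e \<xi> * (cmod (ft f \<xi>))\<^sup>2)"
    using int_g gauss_bounds(1)[of e] by (intro nn_integral_eq_integral) (auto simp: less_imp_le)
  also have "\<dots> \<le> ennreal (cmod (LINT x|lborel. f x * ft W x))"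
    unfolding eq[symmetric] by (intro ennreal_leI) simp
  also have "\<dots> \<le> (\<integral>\<^sup>+x. ennreal (cmod (f x * ft W x)) \<partial>lborel)"
    by (rule integral_norm_bound_ennreal[OF int_fW])
  also have "\<dots> \<le> (\<integral>\<^sup>+x. ennreal (2 * pi) * (\<integral>\<^sup>+y. ennreal (cmod (f x) * cmod (f y) * normal_density 0 e (y - x)) \<partial>lborel) \<partial>lborel)"
  proof (rule nn_integral_mono)
    fix x
    have "ennreal (cmod (f x * ft W x)) \<le> ennreal (cmod (f x)) *
       (ennreal (2 * pi) * (\<integral>\<^sup>+y. ennreal (cmod (f y) * normal_density 0 e (y - x)) \<partial>lborel))"
      unfolding norm_mult by (subst ennreal_mult) (auto intro!: mult_left_mono normW)
    also have "\<dots> = ennreal (2 * pi) * (\<integral>\<^sup>+y. ennreal (cmod (f x)) * ennreal (cmod (f y) * normal_density 0 e (y - x)) \<partial>lborel)"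
      by (subst nn_integral_cmult) (auto simp: mult_ac)
    also have "\<dots> = ennreal (2 * pi) * (\<integral>\<^sup>+y. ennreal (cmod (f x) * cmod (f y) * normal_density 0 e (y - x)) \<partial>lborel)"
      by (simp add: mult.assoc flip: ennreal_mult)
    finally show "ennreal (cmod (f x * ft W x)) \<le>
      ennreal (2 * pi) * (\<integral>\<^sup>+y. ennreal (cmod (f x) * cmod (f y) * normal_density 0 e (y - x)) \<partial>lborel)" .
  qed
  also have "\<dots> = ennreal (2 * pi) * (\<integral>\<^sup>+x. (\<integral>\<^sup>+y. ennreal (cmod (f x) * cmod (f y) * normal_density 0 e (y - x)) \<partial>lborel) \<partial>lborel)"
    by (rule nn_integral_cmult) measurable
  also have "\<dots> \<le> ennreal (2 * pi) * sqnorm f"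
    by (intro mult_left_mono nn_integral_gauss_kernel_le e) auto
  finally show ?thesis .
qed

lemma gauss_tendsto_1: "(\<lambda>n. gauss (inverse (real (Suc n))) \<xi>) \<longlonglongrightarrow> 1"
proof -
  have "(\<lambda>n. exp (- (inverse (real (Suc n)) * \<xi>)\<^sup>2 / 2)) \<longlonglongrightarrow> exp (- (0 * \<xi>)\<^sup>2 / 2)"
    by (intro tendsto_intros LIMSEQ_inverse_real_of_nat) auto
  then show ?thesis
    by (simp add: gauss_def)
qed

text \<open>Fatou's lemma as the Gaussian parameter 1 / (n + 1) tends to 0. This one-sided form of
  Plancherel suffices to extend the transform to \<open>L2\<close>; equality is recovered later from
  inversion.\<close>

lemma sqnorm_ft_le:
  assumes f: "integrable lborel f"
  shows "sqnorm (ft f) \<le> ennreal (2 * pi) * sqnorm f"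
proof -
  have [measurable]: "f \<in> borel_measurable borel"
    using f by auto
  let ?g = "\<lambda>n \<xi>. ennreal (gauss (inverse (real (Suc n))) \<xi> * (cmod (ft f \<xi>))\<^sup>2)"
  have lim: "(\<lambda>n. ?g n \<xi>) \<longlonglongrightarrow> ennreal ((cmod (ft f \<xi>))\<^sup>2)" for \<xi>
    using tendsto_mult_right[OF gauss_tendsto_1[of \<xi>], of "(cmod (ft f \<xi>))\<^sup>2"] by (intro tendsto_ennrealI) simp
  have "sqnorm (ft f) = (\<integral>\<^sup>+\<xi>. liminf (\<lambda>n. ?g n \<xi>) \<partial>lborel)"
    unfolding sqnorm_def by (intro nn_integral_cong lim_imp_Liminf[OF _ lim, symmetric]) simp
  also have "\<dots> \<le> liminf (\<lambda>n. \<integral>\<^sup>+\<xi>. ?g n \<xi> \<partial>lborel)"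
    by (intro nn_integral_liminf) measurable
  also have "\<dots> \<le> limsup (\<lambda>n. \<integral>\<^sup>+\<xi>. ?g n \<xi> \<partial>lborel)"
    by (rule Liminf_le_Limsup) simp
  also have "\<dots> \<le> ennreal (2 * pi) * sqnorm f"
    by (intro Limsup_bounded always_eventually allI sqnorm_ft_gauss_le[OF f]) auto
  finally show ?thesis .
qed

section \<open>Square integrable functions\<close>

lemma L2_iff: "f \<in> L2 \<longleftrightarrow> f \<in> borel_measurable borel \<and> sqnorm f < \<infinity>"
  by (auto simp: L2_def sqnorm_def integrable_iff_bounded)

lemma L2_measurable [measurable_dest]: "f \<in> L2 \<Longrightarrow> f \<in> borel_measurable borel"
  by (simp add: L2_iff)

lemma L2_integrable: "f \<in> L2 \<Longrightarrow> integrable lborel (\<lambda>x. (cmod (f x))\<^sup>2)"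
  by (simp add: L2_def)

lemma sqnorm_eq_integral:
  "f \<in> L2 \<Longrightarrow> sqnorm f = ennreal (LINT x|lborel. (cmod (f x))\<^sup>2)"
  unfolding sqnorm_def by (intro nn_integral_eq_integral L2_integrable) auto

lemma sqnorm_cong_AE:
  "AE x in lborel. f x = g x \<Longrightarrow> sqnorm f = sqnorm g"
  unfolding sqnorm_def by (intro nn_integral_cong_AE) (auto elim: eventually_mono)

lemma sqnorm_cmult: 
  assumes [measurable]: "f \<in> borel_measurable borel"
  shows "sqnorm (\<lambda>x. c * f x) = ennreal ((cmod c)\<^sup>2) * sqnorm f"
  unfolding sqnorm_def norm_mult power_mult_distrib
  by (simp add: ennreal_mult nn_integral_cmult)

text \<open>Replaces the triangle inequality for the norm: with |a + b|^2 \<le> 2 |a|^2 + 2 |b|^2 no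
  square root of an extended real is taken, and the factor 2 is harmless in limits.\<close>

lemma sqnorm_add_le:
  assumes [measurable]: "f \<in> borel_measurable borel" "g \<in> borel_measurable borel"
  shows "sqnorm (\<lambda>x. f x + g x) \<le> 2 * sqnorm f + 2 * sqnorm g"
proof -
  have "(cmod (f x + g x))\<^sup>2 \<le> 2 * (cmod (f x))\<^sup>2 + 2 * (cmod (g x))\<^sup>2" for x
    using power_mono[OF norm_triangle_ineq[of "f x" "g x"], of 2]
      sum_squares_bound[of "cmod (f x)" "cmod (g x)"]
    by (simp add: power2_eq_square algebra_simps)
  then have "sqnorm (\<lambda>x. f x + g x) \<le> (\<integral>\<^sup>+x. ennreal (2 * (cmod (f x))\<^sup>2 + 2 * (cmod (g x))\<^sup>2) \<partial>lborel)"
    unfolding sqnorm_def by (intro nn_integral_mono ennreal_leI)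
  also have "\<dots> = 2 * sqnorm f + 2 * sqnorm g"
    by (simp add: ennreal_plus ennreal_mult nn_integral_add nn_integral_cmult sqnorm_def)
  finally show ?thesis .
qed

lemma sqnorm_diff_commute: "sqnorm (\<lambda>x. f x - g x) = sqnorm (\<lambda>x. g x - f x)"
  by (simp add: sqnorm_def norm_minus_commute)

lemma sqnorm_triangle:
  assumes [measurable]: "f \<in> borel_measurable borel" "g \<in> borel_measurable borel" "h \<in> borel_measurable borel"
  shows "sqnorm (\<lambda>x. f x - h x) \<le> 2 * sqnorm (\<lambda>x. f x - g x) + 2 * sqnorm (\<lambda>x. g x - h x)"
  using sqnorm_add_le[of "\<lambda>x. f x - g x" "\<lambda>x. g x - h x"] by simp

lemma sqnorm_0_iff:
  assumes [measurable]: "f \<in> borel_measurable borel"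
  shows "sqnorm f = 0 \<longleftrightarrow> (AE x in lborel. f x = 0)"
  unfolding sqnorm_def by (subst nn_integral_0_iff_AE) auto

lemma L2_zero: "(\<lambda>x. 0) \<in> L2"
  by (simp add: L2_iff sqnorm_def)

lemma L2_add:
  assumes "f \<in> L2" "g \<in> L2" shows "(\<lambda>x. f x + g x) \<in> L2"
  using assms sqnorm_add_le[of f g] 
  by (auto simp: L2_iff ennreal_mult_less_top intro: le_less_trans)

lemma L2_cmult: "f \<in> L2 \<Longrightarrow> (\<lambda>x. c * f x) \<in> L2"
  by (auto simp: L2_iff sqnorm_cmult ennreal_mult_less_top)

lemma L2_diff:
  assumes "f \<in> L2" "g \<in> L2" shows "(\<lambda>x. f x - g x) \<in> L2"
  using L2_add[OF assms(1) L2_cmult[OF assms(2), of "-1"]] by simp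

lemma L2_mult_bounded:
  assumes f: "f \<in> L2" and [measurable]: "h \<in> borel_measurable borel"
    and h: "AE x in lborel. cmod (h x) \<le> B"
  shows "(\<lambda>x. h x * f x) \<in> L2"
proof -
  have [measurable]: "f \<in> borel_measurable borel" using f by measurable
  have "sqnorm (\<lambda>x. h x * f x) \<le> sqnorm (\<lambda>x. of_real B * f x)"
    unfolding sqnorm_def using h
    by (intro nn_integral_mono_AE)
       (auto simp: norm_mult elim!: eventually_mono intro!: ennreal_leI power_mono mult_right_mono)
  also have "\<dots> < \<infinity>"
    using L2_cmult[OF f] by (simp add: L2_iff)
  finally show ?thesis by (simp add: L2_iff)
qed

lemma L2_cnj: "f \<in> L2 \<Longrightarrow> (\<lambda>x. cnj (f x)) \<in> L2"
  by (auto simp: L2_iff sqnorm_def)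

lemma L2_affine:
  assumes f: "f \<in> L2" and c: "c \<noteq> 0" shows "(\<lambda>x. f (t + c * x)) \<in> L2"
  using lborel_integrable_real_affine[OF L2_integrable[OF f] c, of t] L2_measurable[OF f]
  by (simp add: L2_def)

lemma L2_reflect: "f \<in> L2 \<Longrightarrow> (\<lambda>x. f (- x)) \<in> L2"
  using L2_affine[of f "-1" 0] by simp

lemma sqnorm_affine:
  assumes "f \<in> borel_measurable borel" "\<bar>c\<bar> = 1"
  shows "sqnorm (\<lambda>x. f (t + c * x)) = sqnorm f"
  unfolding sqnorm_def
  by (subst nn_integral_real_affine[of "\<lambda>x. ennreal ((cmod (f x))\<^sup>2)" c t]) (use assms in auto)

lemma L2_cong_AE:
  assumes "f \<in> L2" "g \<in> borel_measurable borel" "AE x in lborel. f x = g x"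
  shows "g \<in> L2"
  using assms sqnorm_cong_AE[OF assms(3)] by (simp add: L2_iff)

lemma L2_mult_integrable:
  assumes f: "f \<in> L2" and g: "g \<in> L2"
  shows "integrable lborel (\<lambda>x. f x * g x)"
proof (rule Bochner_Integration.integrable_bound)
  show "integrable lborel (\<lambda>x. (cmod (f x))\<^sup>2 + (cmod (g x))\<^sup>2)"
    using f g by (intro Bochner_Integration.integrable_add L2_integrable)
  show "(\<lambda>x. f x * g x) \<in> borel_measurable lborel"
    using f g by measurable
  show "AE x in lborel. cmod (f x * g x) \<le> norm ((cmod (f x))\<^sup>2 + (cmod (g x))\<^sup>2)"
  proof (rule AE_I2)
    fix x
    have "2 * (cmod (f x) * cmod (g x)) \<le> (cmod (f x))\<^sup>2 + (cmod (g x))\<^sup>2"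
      using sum_squares_bound[of "cmod (f x)" "cmod (g x)"] by simp
    then have "cmod (f x) * cmod (g x) \<le> (cmod (f x))\<^sup>2 + (cmod (g x))\<^sup>2"
      using mult_nonneg_nonneg[OF norm_ge_zero[of "f x"] norm_ge_zero[of "g x"]] by linarith
    then show "cmod (f x * g x) \<le> norm ((cmod (f x))\<^sup>2 + (cmod (g x))\<^sup>2)"
      by (simp add: norm_mult)
  qed
qed

text \<open>The integral of (|f| - t |g|)^2 is a nonnegative quadratic in t, evaluated at its
  minimiser \<open>?D / ?B\<close>. Working with the integral \<open>?D\<close> of |f g| keeps t
  real, with no phase to choose.\<close>

lemma L2_Cauchy_Schwarz:
  assumes f: "f \<in> L2" and g: "g \<in> L2"
  shows "(cmod (LINT x|lborel. f x * g x))\<^sup>2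
     \<le> (LINT x|lborel. (cmod (f x))\<^sup>2) * (LINT x|lborel. (cmod (g x))\<^sup>2)"
proof -
  let ?A = "LINT x|lborel. (cmod (f x))\<^sup>2" and ?B = "LINT x|lborel. (cmod (g x))\<^sup>2"
  let ?D = "LINT x|lborel. cmod (f x * g x)"
  have int: "integrable lborel (\<lambda>x. cmod (f x * g x))"
    by (intro integrable_norm L2_mult_integrable f g)
  have D: "cmod (LINT x|lborel. f x * g x) \<le> ?D"
    by (rule integral_norm_bound)
  have quad: "0 \<le> ?A - 2 * t * ?D + t\<^sup>2 * ?B" for t
  proof -
    have "0 \<le> (LINT x|lborel. (cmod (f x) - t * cmod (g x))\<^sup>2)"
      by (intro integral_nonneg_AE) auto
    also have "(\<lambda>x. (cmod (f x) - t * cmod (g x))\<^sup>2) =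
        (\<lambda>x. (cmod (f x))\<^sup>2 - 2 * t * cmod (f x * g x) + t\<^sup>2 * (cmod (g x))\<^sup>2)"
      by (simp add: fun_eq_iff power2_eq_square algebra_simps norm_mult)
    also have "(LINT x|lborel. \<dots> x) = ?A - 2 * t * ?D + t\<^sup>2 * ?B"
      using L2_integrable[OF f] L2_integrable[OF g] int by simp
    finally show ?thesis .
  qed
  have "?D\<^sup>2 \<le> ?A * ?B"
  proof (cases "?B = 0")
    case True
    have "?D = 0"
    proof (rule ccontr)
      assume "?D \<noteq> 0"
      \<comment> \<open>With \<open>?B = 0\<close> the quadratic is affine in t, and the chosen t
        gives it the value -1.\<close>
      then show False
        using quad[of "(?A + 1) / (2 * ?D)"] True by simp
    qed
    then show ?thesis using True by simp
  next
    case False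
    moreover have "?B \<ge> 0"
      by (intro integral_nonneg_AE) auto
    ultimately have "?B > 0"
      by linarith
    then show ?thesis
      using quad[of "?D / ?B"] by (simp add: power2_eq_square field_simps)
  qed
  then show ?thesis
    using power_mono[OF D norm_ge_zero, of 2] by linarith
qed

text \<open>Cauchy-Schwarz applied to the difference of g and f R. This is how truncations are
  removed from one factor of a pairing.\<close>

lemma L2_tendsto_integral_mult:
  assumes g: "g \<in> L2" and h: "h \<in> L2" and f: "\<And>R. f R \<in> L2"
    and lim: "((\<lambda>R. sqnorm (\<lambda>x. g x - f R x)) \<longlongrightarrow> 0) F"
  shows "((\<lambda>R. LINT x|lborel. f R x * h x) \<longlongrightarrow> (LINT x|lborel. g x * h x)) F"
proof -
  let ?A = "\<lambda>R. LINT x|lborel. (cmod (g x - f R x))\<^sup>2" and ?B = "LINT x|lborel. (cmod (h x))\<^sup>2"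
  have "((\<lambda>R. ennreal (?A R)) \<longlongrightarrow> ennreal 0) F"
    using lim sqnorm_eq_integral[OF L2_diff[OF g f]] by simp
  then have "(?A \<longlongrightarrow> 0) F"
    by (subst (asm) tendsto_ennreal_iff) auto
  then have "((\<lambda>R. sqrt (?A R * ?B)) \<longlongrightarrow> sqrt (0 * ?B)) F"
    by (intro tendsto_intros)
  then have lim0: "((\<lambda>R. sqrt (?A R * ?B)) \<longlongrightarrow> 0) F"
    by simp
  have "((\<lambda>R. (LINT x|lborel. g x * h x) - (LINT x|lborel. f R x * h x)) \<longlongrightarrow> 0) F"
  proof (rule Lim_null_comparison[OF always_eventually lim0], rule allI)
    fix R
    have "(LINT x|lborel. g x * h x) - (LINT x|lborel. f R x * h x) = (LINT x|lborel. (g x - f R x) * h x)"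
      using L2_mult_integrable[OF g h] L2_mult_integrable[OF f h, of R] by (simp add: algebra_simps)
    then show "norm ((LINT x|lborel. g x * h x) - (LINT x|lborel. f R x * h x)) \<le> sqrt (?A R * ?B)"
      using L2_Cauchy_Schwarz[OF L2_diff[OF g f] h, of R] by (simp add: real_le_rsqrt)
  qed
  from tendsto_diff[OF tendsto_const[of "LINT x|lborel. g x * h x"] this] show ?thesis
    by simp
qed

section \<open>Completeness\<close>

lemma sqnorm_tendsto_le_liminf:
  assumes [measurable]: "\<And>n. f n \<in> borel_measurable borel" "g \<in> borel_measurable borel"
    and lim: "AE x in lborel. (\<lambda>n. f n x) \<longlonglongrightarrow> g x"
  shows "sqnorm g \<le> liminf (\<lambda>n. sqnorm (f n))"
proof -
  have "sqnorm g = (\<integral>\<^sup>+x. liminf (\<lambda>n. ennreal ((cmod (f n x))\<^sup>2)) \<partial>lborel)"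
    unfolding sqnorm_def
  proof (intro nn_integral_cong_AE)
    show "AE x in lborel. ennreal ((cmod (g x))\<^sup>2) = liminf (\<lambda>n. ennreal ((cmod (f n x))\<^sup>2))"
      using lim
    proof eventually_elim
      case (elim x)
      then have "(\<lambda>n. ennreal ((cmod (f n x))\<^sup>2)) \<longlonglongrightarrow> ennreal ((cmod (g x))\<^sup>2)"
        by (intro tendsto_ennrealI tendsto_intros)
      then show ?case by (intro lim_imp_Liminf[symmetric]) auto
    qed
  qed
  also have "\<dots> \<le> liminf (\<lambda>n. sqnorm (f n))"
    unfolding sqnorm_def by (intro nn_integral_liminf) measurable
  finally show ?thesis .
qed

text \<open>Each term of the series is at most its sum C, so the n-th increment is at most sqrt C /
  2^n and the increments are dominated by a geometric series.\<close>

lemma convergent_of_summable_weighted_differences: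
  fixes f :: "nat \<Rightarrow> complex"
  assumes "(\<Sum>n. ennreal (4 ^ n * (cmod (f (Suc n) - f n))\<^sup>2)) < \<infinity>"
  shows "convergent f"
proof -
  define d where "d n = ennreal (4 ^ n * (cmod (f (Suc n) - f n))\<^sup>2)" for n
  have "suminf d < \<infinity>"
    using assms unfolding d_def .
  then obtain C where C: "C \<ge> 0" "suminf d = ennreal C"
    by (cases "suminf d" rule: ennreal_cases) auto
  have four: "((2::real) ^ n)\<^sup>2 = 4 ^ n" for n
    using power_mult[of "2::real" n 2] power_mult[of "2::real" 2 n] by (simp add: mult.commute)
  have bound: "cmod (f (Suc n) - f n) \<le> sqrt C * (1/2) ^ n" for n
  proof -
    have "sum d {n} \<le> suminf d"
      by (rule sum_le_suminf) auto
    then have "ennreal (4 ^ n * (cmod (f (Suc n) - f n))\<^sup>2) \<le> ennreal C"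
      unfolding C(2) by (simp add: d_def)
    then have "4 ^ n * (cmod (f (Suc n) - f n))\<^sup>2 \<le> C"
      using C by (simp add: ennreal_le_iff)
    then have "(2 ^ n * cmod (f (Suc n) - f n))\<^sup>2 \<le> C"
      by (simp add: power_mult_distrib four)
    then have "2 ^ n * cmod (f (Suc n) - f n) \<le> sqrt C"
      by (rule real_le_rsqrt)
    then show ?thesis by (simp add: field_simps power_divide)
  qed
  have "summable (\<lambda>n. f (Suc n) - f n)"
    by (rule summable_comparison_test'[of "\<lambda>n. sqrt C * (1/2) ^ n" 0]) (use bound in auto)
  then have "convergent (\<lambda>n. f 0 + (\<Sum>i<n. f (Suc i) - f i))"
    by (intro convergent_add convergent_const) (simp add: summable_iff_convergent)
  then show ?thesis
    by (simp add: sum_lessThan_telescope)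
qed

text \<open>Riesz-Fischer for a family with a real index: a rapidly Cauchy sequence converges almost
  everywhere, and Fatou's lemma upgrades this to mean square convergence of the whole
  family.\<close>

lemma L2_complete:
  fixes F :: "real \<Rightarrow> real \<Rightarrow> complex"
  assumes F: "\<And>R. F R \<in> L2"
    and cauchy: "\<And>e. e > 0 \<Longrightarrow> \<exists>R0. \<forall>R\<ge>R0. \<forall>R'\<ge>R0. sqnorm (\<lambda>x. F R x - F R' x) \<le> ennreal e"
  shows "\<exists>g\<in>L2. ((\<lambda>R. sqnorm (\<lambda>x. g x - F R x)) \<longlongrightarrow> 0) at_top"
proof -
  have [measurable]: "F R \<in> borel_measurable borel" for R
    using F by measurable
  \<comment> \<open>The tolerance 8^-n, multiplied by the weight 4^n of the pointwise criterion,
    leaves the summable 2^-n.\<close>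
  have "\<exists>R0. \<forall>R\<ge>R0. \<forall>R'\<ge>R0. sqnorm (\<lambda>x. F R x - F R' x) \<le> ennreal ((1/8) ^ n)" for n :: nat
    by (rule cauchy) simp
  then obtain r where r: "\<And>n R R'. R \<ge> r n \<Longrightarrow> R' \<ge> r n \<Longrightarrow> sqnorm (\<lambda>x. F R x - F R' x) \<le> ennreal ((1/8) ^ n)"
    by metis
  \<comment> \<open>The partial sums of |r i| are at least every r m with m \<le> n, so r itself may
    fail to be monotone.\<close>
  define s where "s n = (\<Sum>i\<le>n. \<bar>r i\<bar>)" for n :: nat
  have s: "r m \<le> s n" if "m \<le> n" for m n
  proof -
    have "\<bar>r m\<bar> \<le> s n"
      unfolding s_def by (rule member_le_sum) (use that in auto)
    then show ?thesis by linarith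
  qed
  define f where "f n = F (s n)" for n
  have [measurable]: "f n \<in> borel_measurable borel" for n
    unfolding f_def by measurable
  \<comment> \<open>Where the sequence diverges \<open>lim\<close> takes an unspecified value; this
    happens only on a null set.\<close>
  define g where "g x = lim (\<lambda>n. f n x)" for x
  have g_meas [measurable]: "g \<in> borel_measurable borel"
    unfolding g_def by measurable
  have "(\<integral>\<^sup>+x. (\<Sum>n. ennreal (4 ^ n * (cmod (f (Suc n) x - f n x))\<^sup>2)) \<partial>lborel) =
      (\<Sum>n. \<integral>\<^sup>+x. ennreal (4 ^ n * (cmod (f (Suc n) x - f n x))\<^sup>2) \<partial>lborel)"
    by (rule nn_integral_suminf) measurable
  also have "\<dots> = (\<Sum>n. ennreal (4 ^ n) * sqnorm (\<lambda>x. f (Suc n) x - f n x))"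
    unfolding sqnorm_def by (simp add: ennreal_mult nn_integral_cmult)
  also have "\<dots> \<le> (\<Sum>n. ennreal ((1/2) ^ n))"
  proof (intro suminf_le summableI allI)
    fix n
    have "ennreal (4 ^ n) * sqnorm (\<lambda>x. f (Suc n) x - f n x) \<le> ennreal (4 ^ n) * ennreal ((1/8) ^ n)"
      unfolding f_def using s by (intro mult_left_mono r) auto
    also have "\<dots> = ennreal ((1/2) ^ n)"
      by (simp flip: ennreal_mult power_mult_distrib)
    finally show "ennreal (4 ^ n) * sqnorm (\<lambda>x. f (Suc n) x - f n x) \<le> ennreal ((1/2) ^ n)" .
  qed
  also have "\<dots> = ennreal (\<Sum>n. (1/2) ^ n)"
    by (rule suminf_ennreal2) (auto intro: summable_geometric)
  also have "\<dots> < \<infinity>" by simp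
  finally have "AE x in lborel. (\<Sum>n. ennreal (4 ^ n * (cmod (f (Suc n) x - f n x))\<^sup>2)) \<noteq> \<infinity>"
    by (intro nn_integral_PInf_AE) (auto simp: less_top)
  then have lim: "AE x in lborel. (\<lambda>n. f n x) \<longlonglongrightarrow> g x"
  proof eventually_elim
    case (elim x)
    then have "convergent (\<lambda>n. f n x)"
      by (intro convergent_of_summable_weighted_differences) (simp add: less_top)
    then show ?case unfolding g_def by (simp add: convergent_LIMSEQ_iff)
  qed
  \<comment> \<open>R stays fixed while n tends to infinity; from n = m on, both R and s n are at
    least r m.\<close>
  have bound: "sqnorm (\<lambda>x. g x - F R x) \<le> ennreal ((1/8) ^ m)" if R: "R \<ge> r m" for R m
  proof -
    have "sqnorm (\<lambda>x. g x - F R x) \<le> liminf (\<lambda>n. sqnorm (\<lambda>x. f n x - F R x))"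
      using lim by (intro sqnorm_tendsto_le_liminf) (auto elim!: eventually_mono intro!: tendsto_diff)
    also have "\<dots> \<le> limsup (\<lambda>n. sqnorm (\<lambda>x. f n x - F R x))"
      by (rule Liminf_le_Limsup) simp
    also have "\<dots> \<le> ennreal ((1/8) ^ m)"
      using s R by (intro Limsup_bounded) (auto simp: f_def eventually_sequentially intro!: exI[of _ m] r)
    finally show ?thesis .
  qed
  have "((\<lambda>R. sqnorm (\<lambda>x. g x - F R x)) \<longlongrightarrow> 0) at_top"
  proof (rule tendsto_0_if_Limsup_eq_0_ennreal)
    have le: "Limsup at_top (\<lambda>R. sqnorm (\<lambda>x. g x - F R x)) \<le> ennreal ((1/8) ^ m)" for m
      by (intro Limsup_bounded eventually_at_top_linorderI[of "r m"] bound)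
    have "(\<lambda>m. ennreal ((1/8) ^ m)) \<longlonglongrightarrow> ennreal 0"
      by (intro tendsto_ennrealI LIMSEQ_power_zero) auto
    from LIMSEQ_le_const[OF this, of "Limsup at_top (\<lambda>R. sqnorm (\<lambda>x. g x - F R x))"] le
    show "Limsup at_top (\<lambda>R. sqnorm (\<lambda>x. g x - F R x)) = 0"
      by auto
  qed
  moreover have "g \<in> L2"
  proof -
    have "(\<lambda>x. g x - F (r 0) x) \<in> L2"
      using bound[of 0 "r 0"] by (auto simp: L2_iff intro: le_less_trans)
    from L2_add[OF this F[of "r 0"]] show ?thesis by simp
  qed
  ultimately show ?thesis by blast
qed

section \<open>The Fourier transform on square integrable functions\<close>

lemma sqnorm_tendsto_add:
  assumes [measurable]: "f \<in> borel_measurable borel" "g \<in> borel_measurable borel"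
      "\<And>R. h R \<in> borel_measurable borel"
    and "((\<lambda>R. sqnorm (\<lambda>x. f x - h R x)) \<longlongrightarrow> 0) F" "((\<lambda>R. sqnorm (\<lambda>x. g x - k R x)) \<longlongrightarrow> 0) F"
    and [measurable]: "\<And>R. k R \<in> borel_measurable borel"
  shows "((\<lambda>R. sqnorm (\<lambda>x. (f x + g x) - (h R x + k R x))) \<longlongrightarrow> 0) F"
proof (rule tendsto_sandwich[OF always_eventually always_eventually tendsto_const])
  show "\<forall>R. sqnorm (\<lambda>x. (f x + g x) - (h R x + k R x)) \<le>
      2 * sqnorm (\<lambda>x. f x - h R x) + 2 * sqnorm (\<lambda>x. g x - k R x)"
    using sqnorm_add_le[of "\<lambda>x. f x - h R x" "\<lambda>x. g x - k R x" for R] by (simp add: algebra_simps)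
  have "((\<lambda>R. 2 * sqnorm (\<lambda>x. f x - h R x) + 2 * sqnorm (\<lambda>x. g x - k R x)) \<longlongrightarrow> 2 * 0 + 2 * 0) F"
    using assms by (intro tendsto_add ennreal_tendsto_cmult) auto
  then show "((\<lambda>R. 2 * sqnorm (\<lambda>x. f x - h R x) + 2 * sqnorm (\<lambda>x. g x - k R x)) \<longlongrightarrow> 0) F"
    by simp
qed auto

text \<open>The difference f - g is approximated by h R - h R = 0.\<close>

lemma sqnorm_tendsto_unique:
  assumes [measurable]: "f \<in> borel_measurable borel" "g \<in> borel_measurable borel"
      "\<And>R. h R \<in> borel_measurable borel"
    and F: "F \<noteq> bot"
    and lim: "((\<lambda>R. sqnorm (\<lambda>x. f x - h R x)) \<longlongrightarrow> 0) F" "((\<lambda>R. sqnorm (\<lambda>x. g x - h R x)) \<longlongrightarrow> 0) F"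
  shows "AE x in lborel. f x = g x"
proof -
  have "((\<lambda>R. sqnorm (\<lambda>x. (f x + - g x) - (h R x + - h R x))) \<longlongrightarrow> 0) F"
    using lim(2) sqnorm_diff_commute[of g "h R" for R]
    by (intro sqnorm_tendsto_add lim) auto
  then have "sqnorm (\<lambda>x. f x - g x) = 0"
    by (simp add: tendsto_const_iff[OF F])
  then show ?thesis
    by (simp add: sqnorm_0_iff)
qed

section \<open>Truncations and the mean square limit\<close>

definition cut :: "real \<Rightarrow> (real \<Rightarrow> complex) \<Rightarrow> real \<Rightarrow> complex" where
  "cut R f x = indicator {-R..R} x * f x"

lemma borel_measurable_cut [measurable]:
  "f \<in> borel_measurable borel \<Longrightarrow> cut R f \<in> borel_measurable borel"
  unfolding cut_def by measurable

lemma fourier_trunc_eq_ft_cut: "fourier_trunc R f = ft (cut R f)"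
  by (auto simp: fourier_trunc_def ft_def cut_def set_lebesgue_integral_def fun_eq_iff indicator_def
      intro!: Bochner_Integration.integral_cong)

lemma borel_measurable_fourier_trunc [measurable]:
  "f \<in> borel_measurable borel \<Longrightarrow> fourier_trunc R f \<in> borel_measurable borel"
  unfolding fourier_trunc_eq_ft_cut using borel_measurable_ft[of "cut R f"] by simp

lemma L2_indicator:
  assumes "A \<in> sets lborel" "emeasure lborel A < \<infinity>"
  shows "(\<lambda>x. indicator A x) \<in> L2"
proof -
  have "sqnorm (\<lambda>x. indicator A x) = (\<integral>\<^sup>+x. indicator A x \<partial>lborel)"
    unfolding sqnorm_def by (intro nn_integral_cong) (auto simp: indicator_def)
  then show ?thesis
    using assms by (simp add: L2_iff)
qed

lemma L2_cut: "f \<in> L2 \<Longrightarrow> cut R f \<in> L2"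
  unfolding cut_def by (rule L2_mult_bounded[where B = 1]) (auto simp: indicator_def)

lemma integrable_cut: "f \<in> L2 \<Longrightarrow> integrable lborel (cut R f)"
  unfolding cut_def[abs_def] by (intro L2_mult_integrable L2_indicator) (auto simp: emeasure_lborel_Icc_eq)

lemma sqnorm_cut_tendsto:
  assumes f: "f \<in> L2"
  shows "((\<lambda>R. sqnorm (\<lambda>x. f x - cut R f x)) \<longlongrightarrow> 0) at_top"
proof -
  have [measurable]: "f \<in> borel_measurable borel" using f by measurable
  have "((\<lambda>R. LINT x|lborel. (cmod (f x - cut R f x))\<^sup>2) \<longlongrightarrow> integral\<^sup>L lborel (\<lambda>x::real. 0::real)) at_top"
  proof (rule integral_dominated_convergence_at_top)
    show "integrable lborel (\<lambda>x. (cmod (f x))\<^sup>2)"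
      by (rule L2_integrable[OF f])
    show "\<forall>\<^sub>F R in at_top. AE x in lborel. norm ((cmod (f x - cut R f x))\<^sup>2) \<le> (cmod (f x))\<^sup>2"
      by (intro always_eventually allI AE_I2) (auto simp: cut_def indicator_def)
    show "AE x in lborel. ((\<lambda>R. (cmod (f x - cut R f x))\<^sup>2) \<longlongrightarrow> 0) at_top"
    proof (intro AE_I2 tendsto_eventually)
      fix x
      show "\<forall>\<^sub>F R in at_top. (cmod (f x - cut R f x))\<^sup>2 = 0"
        using eventually_ge_at_top[of "\<bar>x\<bar>"] by eventually_elim (auto simp: cut_def indicator_def)
    qed
  qed measurable
  then have "((\<lambda>R. ennreal (LINT x|lborel. (cmod (f x - cut R f x))\<^sup>2)) \<longlongrightarrow> ennreal 0) at_top"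
    by (intro tendsto_ennrealI) simp
  then show ?thesis
    by (simp add: sqnorm_eq_integral L2_diff[OF f L2_cut[OF f]])
qed

lemma ft_diff:
  assumes "integrable lborel f" "integrable lborel g"
  shows "ft (\<lambda>x. f x - g x) = (\<lambda>\<xi>. ft f \<xi> - ft g \<xi>)"
  unfolding ft_def fun_eq_iff using integrable_ft[OF assms(1)] integrable_ft[OF assms(2)]
  by (simp add: left_diff_distrib)

lemma L2_ft:
  assumes "f \<in> L2" "integrable lborel f"
  shows "ft f \<in> L2"
  using sqnorm_ft_le[OF assms(2)] assms
  by (auto simp: L2_iff ennreal_mult_less_top intro: le_less_trans borel_measurable_ft[simplified])

lemma L2_fourier_trunc: "f \<in> L2 \<Longrightarrow> fourier_trunc R f \<in> L2"
  unfolding fourier_trunc_eq_ft_cut by (intro L2_ft L2_cut integrable_cut)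

lemma fourier_trunc_cauchy:
  assumes f: "f \<in> L2" and e: "e > 0"
  shows "\<exists>R0. \<forall>R\<ge>R0. \<forall>R'\<ge>R0. sqnorm (\<lambda>\<xi>. fourier_trunc R f \<xi> - fourier_trunc R' f \<xi>) \<le> ennreal e"
proof -
  have [measurable]: "f \<in> borel_measurable borel" using f by measurable
  \<comment> \<open>The factor 2 pi of \<open>sqnorm_ft_le\<close> times the two terms 2 * d of
    \<open>sqnorm_triangle\<close> gives 8 * pi * d = e.\<close>
  define d where "d = e / (8 * pi)"
  have "d > 0" using e by (simp add: d_def)
  then have "\<forall>\<^sub>F R in at_top. sqnorm (\<lambda>x. f x - cut R f x) < ennreal d"
    using sqnorm_cut_tendsto[OF f] by (intro order_tendstoD(2)) auto
  then obtain R0 where R0: "\<And>R. R \<ge> R0 \<Longrightarrow> sqnorm (\<lambda>x. f x - cut R f x) \<le> ennreal d"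
    unfolding eventually_at_top_linorder by (auto intro: less_imp_le)
  have "sqnorm (\<lambda>\<xi>. fourier_trunc R f \<xi> - fourier_trunc R' f \<xi>) \<le> ennreal e" if R: "R \<ge> R0" "R' \<ge> R0" for R R'
  proof -
    have "sqnorm (\<lambda>\<xi>. fourier_trunc R f \<xi> - fourier_trunc R' f \<xi>) = sqnorm (ft (\<lambda>x. cut R f x - cut R' f x))"
      unfolding fourier_trunc_eq_ft_cut using ft_diff[OF integrable_cut integrable_cut, OF f f] by simp
    also have "\<dots> \<le> ennreal (2 * pi) * sqnorm (\<lambda>x. cut R f x - cut R' f x)"
      by (intro sqnorm_ft_le Bochner_Integration.integrable_diff integrable_cut f)
    also have "\<dots> \<le> ennreal (2 * pi) * (2 * ennreal d + 2 * ennreal d)"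
    proof (rule mult_left_mono)
      have "sqnorm (\<lambda>x. cut R f x - cut R' f x) \<le> 2 * sqnorm (\<lambda>x. cut R f x - f x) + 2 * sqnorm (\<lambda>x. f x - cut R' f x)"
        by (rule sqnorm_triangle) measurable
      also have "\<dots> \<le> 2 * ennreal d + 2 * ennreal d"
        using R0[OF R(1)] R0[OF R(2)] sqnorm_diff_commute[of f "cut R f"]
        by (intro add_mono mult_left_mono) auto
      finally show "sqnorm (\<lambda>x. cut R f x - cut R' f x) \<le> 2 * ennreal d + 2 * ennreal d" .
    qed auto
    also have "2 * ennreal d + 2 * ennreal d = ennreal (4 * d)"
      using \<open>d > 0\<close> ennreal_mult[of 2 d] ennreal_plus[of "2 * d" "2 * d"] by simp
    also have "ennreal (2 * pi) * ennreal (4 * d) = ennreal e"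
      using \<open>d > 0\<close> by (subst ennreal_mult[symmetric]) (auto simp: d_def)
    finally show ?thesis .
  qed
  then show ?thesis by blast
qed

text \<open>Completeness provides a witness for the choice in \<open>fourier\<close>. Apart from
  \<open>fourier_cong_AE\<close>, the definition is not unfolded again.\<close>

lemma fourier_L2_tendsto:
  assumes f: "f \<in> L2"
  shows L2_fourier: "fourier f \<in> L2"
    and sqnorm_fourier_trunc_tendsto: "((\<lambda>R. sqnorm (\<lambda>\<xi>. fourier f \<xi> - fourier_trunc R f \<xi>)) \<longlongrightarrow> 0) at_top"
proof -
  have "\<exists>g\<in>L2. ((\<lambda>R. sqnorm (\<lambda>x. g x - fourier_trunc R f x)) \<longlongrightarrow> 0) at_top"
    by (rule L2_complete[OF L2_fourier_trunc fourier_trunc_cauchy]) (use f in auto)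
  then have "\<exists>g. g \<in> L2 \<and>
     ((\<lambda>R. \<integral>\<^sup>+ \<xi>. ennreal ((cmod (g \<xi> - fourier_trunc R f \<xi>))\<^sup>2) \<partial>lborel) \<longlongrightarrow> 0) at_top"
    unfolding sqnorm_def by blast
  from someI_ex[OF this] show "fourier f \<in> L2"
    "((\<lambda>R. sqnorm (\<lambda>\<xi>. fourier f \<xi> - fourier_trunc R f \<xi>)) \<longlongrightarrow> 0) at_top"
    unfolding fourier_def sqnorm_def by blast+
qed

lemma fourier_measurable: "f \<in> L2 \<Longrightarrow> fourier f \<in> borel_measurable borel"
  using L2_fourier by measurable

text \<open>Uniqueness of mean square limits. Rules for \<open>fourier\<close> are proved by
  exhibiting a candidate and checking it on truncations.\<close>

lemma fourier_eqI:
  assumes f: "f \<in> L2" and g: "g \<in> borel_measurable borel"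
    and "((\<lambda>R. sqnorm (\<lambda>\<xi>. g \<xi> - fourier_trunc R f \<xi>)) \<longlongrightarrow> 0) at_top"
  shows "AE \<xi> in lborel. fourier f \<xi> = g \<xi>"
  using assms fourier_measurable[OF f] L2_measurable[OF f] sqnorm_fourier_trunc_tendsto[OF f]
  by (intro sqnorm_tendsto_unique[where F = at_top and h = "\<lambda>R. fourier_trunc R f"]) auto

text \<open>The conclusion is an equality of functions: the choice depends on f only through its
  truncated integrals, and these ignore null sets.\<close>

lemma fourier_cong_AE:
  assumes [measurable]: "f \<in> borel_measurable borel" "g \<in> borel_measurable borel"
    and eq: "AE x in lborel. f x = g x"
  shows "fourier f = fourier g"
proof -
  have "fourier_trunc R f = fourier_trunc R g" for R
    unfolding fourier_trunc_def set_lebesgue_integral_def fun_eq_iff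
    by (intro allI integral_cong_AE) (use eq in \<open>auto elim: eventually_mono\<close>)
  then show ?thesis
    by (simp add: fourier_def)
qed

section \<open>Algebraic rules for the transform\<close>

lemma fourier_trunc_add:
  assumes "f \<in> L2" "g \<in> L2"
  shows "fourier_trunc R (\<lambda>x. f x + g x) \<xi> = fourier_trunc R f \<xi> + fourier_trunc R g \<xi>"
  unfolding fourier_trunc_eq_ft_cut ft_def
  using integrable_ft[OF integrable_cut[OF assms(1)]] integrable_ft[OF integrable_cut[OF assms(2)]]
  by (subst Bochner_Integration.integral_add[symmetric])
     (auto simp: cut_def distrib_left distrib_right intro!: Bochner_Integration.integral_cong)

lemma fourier_add:
  assumes f: "f \<in> L2" and g: "g \<in> L2"
  shows "AE \<xi> in lborel. fourier (\<lambda>x. f x + g x) \<xi> = fourier f \<xi> + fourier g \<xi>"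
proof (rule fourier_eqI)
  have [measurable]: "f \<in> borel_measurable borel" "g \<in> borel_measurable borel"
     "fourier f \<in> borel_measurable borel" "fourier g \<in> borel_measurable borel"
    using f g by (auto intro: fourier_measurable L2_measurable)
  show "(\<lambda>x. f x + g x) \<in> L2" by (intro L2_add f g)
  show "(\<lambda>\<xi>. fourier f \<xi> + fourier g \<xi>) \<in> borel_measurable borel" by measurable
  show "((\<lambda>R. sqnorm (\<lambda>\<xi>. fourier f \<xi> + fourier g \<xi> - fourier_trunc R (\<lambda>x. f x + g x) \<xi>)) \<longlongrightarrow> 0) at_top"
    unfolding fourier_trunc_add[OF f g]
    by (intro sqnorm_tendsto_add sqnorm_fourier_trunc_tendsto f g) measurable
qed

lemma fourier_cmult:
  assumes f: "f \<in> L2"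
  shows "AE \<xi> in lborel. fourier (\<lambda>x. c * f x) \<xi> = c * fourier f \<xi>"
proof (rule fourier_eqI)
  have [measurable]: "f \<in> borel_measurable borel" "fourier f \<in> borel_measurable borel"
    using f by (auto intro: fourier_measurable L2_measurable)
  show "(\<lambda>x. c * f x) \<in> L2" by (intro L2_cmult f)
  show "(\<lambda>\<xi>. c * fourier f \<xi>) \<in> borel_measurable borel" by measurable
  have *: "fourier_trunc R (\<lambda>x. c * f x) \<xi> = c * fourier_trunc R f \<xi>" for R \<xi>
    unfolding fourier_trunc_eq_ft_cut ft_def
    by (subst integral_mult_right_zero[symmetric]) (auto simp: cut_def mult_ac)
  have "((\<lambda>R. ennreal ((cmod c)\<^sup>2) * sqnorm (\<lambda>\<xi>. fourier f \<xi> - fourier_trunc R f \<xi>)) \<longlongrightarrow> ennreal ((cmod c)\<^sup>2) * 0) at_top"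
    by (intro ennreal_tendsto_cmult sqnorm_fourier_trunc_tendsto f) auto
  then show "((\<lambda>R. sqnorm (\<lambda>\<xi>. c * fourier f \<xi> - fourier_trunc R (\<lambda>x. c * f x) \<xi>)) \<longlongrightarrow> 0) at_top"
    unfolding * by (simp add: sqnorm_cmult flip: right_diff_distrib)
qed

lemma fourier_reflect:
  assumes f: "f \<in> L2"
  shows "AE \<xi> in lborel. fourier (\<lambda>x. f (- x)) \<xi> = fourier f (- \<xi>)"
proof (rule fourier_eqI)
  have [measurable]: "f \<in> borel_measurable borel" "fourier f \<in> borel_measurable borel"
    using f by (auto intro: fourier_measurable L2_measurable)
  show "(\<lambda>x. f (- x)) \<in> L2" by (intro L2_reflect f)
  show "(\<lambda>\<xi>. fourier f (- \<xi>)) \<in> borel_measurable borel" by measurable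
  \<comment> \<open>The interval of truncation is symmetric, so truncation commutes with
    reflection.\<close>
  have *: "fourier_trunc R (\<lambda>x. f (- x)) \<xi> = fourier_trunc R f (- \<xi>)" for R \<xi>
    unfolding fourier_trunc_eq_ft_cut ft_def
    by (subst lborel_integral_real_affine[of "-1" _ 0])
       (auto simp: cut_def indicator_def intro!: Bochner_Integration.integral_cong)
  have "sqnorm (\<lambda>\<xi>. fourier f (- \<xi>) - fourier_trunc R f (- \<xi>)) = sqnorm (\<lambda>\<xi>. fourier f \<xi> - fourier_trunc R f \<xi>)" for R
    using sqnorm_affine[of "\<lambda>\<xi>. fourier f \<xi> - fourier_trunc R f \<xi>" "-1" 0] by simp
  then show "((\<lambda>R. sqnorm (\<lambda>\<xi>. fourier f (- \<xi>) - fourier_trunc R (\<lambda>x. f (- x)) \<xi>)) \<longlongrightarrow> 0) at_top"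
    unfolding * by (simp add: sqnorm_fourier_trunc_tendsto f)
qed

lemma fourier_cnj:
  assumes f: "f \<in> L2"
  shows "AE \<xi> in lborel. fourier (\<lambda>x. cnj (f x)) \<xi> = cnj (fourier f (- \<xi>))"
proof (rule fourier_eqI)
  have [measurable]: "f \<in> borel_measurable borel" "fourier f \<in> borel_measurable borel"
    using f by (auto intro: fourier_measurable L2_measurable)
  show "(\<lambda>x. cnj (f x)) \<in> L2" by (intro L2_cnj f)
  show "(\<lambda>\<xi>. cnj (fourier f (- \<xi>))) \<in> borel_measurable borel" by measurable
  have "cut R (\<lambda>x. cnj (f x)) = (\<lambda>x. cnj (cut R f x))" for R
    by (auto simp: cut_def indicator_def)
  then have *: "fourier_trunc R (\<lambda>x. cnj (f x)) \<xi> = cnj (fourier_trunc R f (- \<xi>))" for R \<xi>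
    unfolding fourier_trunc_eq_ft_cut by (simp add: ft_cnj)
  have "sqnorm (\<lambda>\<xi>. cnj (fourier f (- \<xi>)) - cnj (fourier_trunc R f (- \<xi>))) = sqnorm (\<lambda>\<xi>. fourier f \<xi> - fourier_trunc R f \<xi>)" for R
    using sqnorm_affine[of "\<lambda>\<xi>. fourier f \<xi> - fourier_trunc R f \<xi>" "-1" 0] 
    by (simp add: sqnorm_def flip: complex_cnj_diff)
  then show "((\<lambda>R. sqnorm (\<lambda>\<xi>. cnj (fourier f (- \<xi>)) - fourier_trunc R (\<lambda>x. cnj (f x)) \<xi>)) \<longlongrightarrow> 0) at_top"
    unfolding * by (simp add: sqnorm_fourier_trunc_tendsto f)
qed

lemma L2_modulate: "f \<in> L2 \<Longrightarrow> (\<lambda>x. exp (- (\<i> * of_real (x * a))) * f x) \<in> L2"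
  by (rule L2_mult_bounded[where B = 1]) auto

lemma fourier_modulate:
  assumes f: "f \<in> L2"
  shows "AE \<xi> in lborel. fourier (\<lambda>x. exp (- (\<i> * of_real (x * a))) * f x) \<xi> = fourier f (a + \<xi>)"
proof (rule fourier_eqI)
  have [measurable]: "f \<in> borel_measurable borel" "fourier f \<in> borel_measurable borel"
    using f by (auto intro: fourier_measurable L2_measurable)
  show "(\<lambda>x. exp (- (\<i> * of_real (x * a))) * f x) \<in> L2" by (intro L2_modulate f)
  show "(\<lambda>\<xi>. fourier f (a + \<xi>)) \<in> borel_measurable borel" by measurable
  have *: "fourier_trunc R (\<lambda>x. exp (- (\<i> * of_real (x * a))) * f x) \<xi> = fourier_trunc R f (a + \<xi>)" for R \<xi>
    unfolding fourier_trunc_eq_ft_cut ft_def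
    by (intro Bochner_Integration.integral_cong)
       (auto simp: cut_def algebra_simps exp_add[symmetric] simp flip: exp_diff)
  have "sqnorm (\<lambda>\<xi>. fourier f (a + \<xi>) - fourier_trunc R f (a + \<xi>)) = sqnorm (\<lambda>\<xi>. fourier f \<xi> - fourier_trunc R f \<xi>)" for R
    using sqnorm_affine[of "\<lambda>\<xi>. fourier f \<xi> - fourier_trunc R f \<xi>" 1 a] by simp
  then show "((\<lambda>R. sqnorm (\<lambda>\<xi>. fourier f (a + \<xi>) -
      fourier_trunc R (\<lambda>x. exp (- (\<i> * of_real (x * a))) * f x) \<xi>)) \<longlongrightarrow> 0) at_top"
    unfolding * by (simp add: sqnorm_fourier_trunc_tendsto f)
qed

text \<open>The mean square bound controls the transform of \<open>f - cut R f\<close>, so the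
  truncated integrals converge to \<open>ft f\<close>. This gives functions lying in both spaces a
  pointwise formula.\<close>

lemma fourier_eq_ft:
  assumes f: "f \<in> L2" and int: "integrable lborel f"
  shows "AE \<xi> in lborel. fourier f \<xi> = ft f \<xi>"
proof -
  have [measurable]: "f \<in> borel_measurable borel" "fourier f \<in> borel_measurable borel"
    using f by (auto intro: fourier_measurable L2_measurable)
  have [measurable]: "ft f \<in> borel_measurable borel"
    using borel_measurable_ft[of f] by simp
  have lim: "((\<lambda>R. sqnorm (\<lambda>\<xi>. ft f \<xi> - fourier_trunc R f \<xi>)) \<longlongrightarrow> 0) at_top"
  proof (rule tendsto_sandwich[OF always_eventually always_eventually tendsto_const])
    show "\<forall>R. sqnorm (\<lambda>\<xi>. ft f \<xi> - fourier_trunc R f \<xi>) \<le> ennreal (2 * pi) * sqnorm (\<lambda>x. f x - cut R f x)"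
    proof
      fix R
      have "sqnorm (\<lambda>\<xi>. ft f \<xi> - fourier_trunc R f \<xi>) = sqnorm (ft (\<lambda>x. f x - cut R f x))"
        unfolding fourier_trunc_eq_ft_cut using ft_diff[OF int integrable_cut[OF f]] by simp
      also have "\<dots> \<le> ennreal (2 * pi) * sqnorm (\<lambda>x. f x - cut R f x)"
        by (intro sqnorm_ft_le Bochner_Integration.integrable_diff int integrable_cut[OF f])
      finally show "sqnorm (\<lambda>\<xi>. ft f \<xi> - fourier_trunc R f \<xi>) \<le> ennreal (2 * pi) * sqnorm (\<lambda>x. f x - cut R f x)" .
    qed
    show "((\<lambda>R. ennreal (2 * pi) * sqnorm (\<lambda>x. f x - cut R f x)) \<longlongrightarrow> 0) at_top"
      using ennreal_tendsto_cmult[OF _ sqnorm_cut_tendsto[OF f], of "ennreal (2 * pi)"] by simp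
  qed auto
  show ?thesis
    by (rule fourier_eqI[OF f _ lim]) measurable
qed

text \<open>The two factors are truncated independently, at R and S, where Fubini's formula applies;
  the cuts are then removed one at a time by continuity of the pairing.\<close>

lemma fourier_multiplication_formula:
  assumes f: "f \<in> L2" and g: "g \<in> L2"
  shows "(LINT \<xi>|lborel. fourier f \<xi> * g \<xi>) = (LINT x|lborel. f x * fourier g x)"
proof -
  have eq: "(LINT \<xi>|lborel. fourier_trunc R f \<xi> * cut S g \<xi>) = (LINT x|lborel. cut R f x * fourier_trunc S g x)" for R S
    unfolding fourier_trunc_eq_ft_cut by (intro ft_multiplication_formula integrable_cut f g)
  have "(LINT \<xi>|lborel. fourier f \<xi> * cut S g \<xi>) = (LINT x|lborel. f x * fourier_trunc S g x)" for S
  proof (rule tendsto_unique)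
    show "((\<lambda>R. LINT \<xi>|lborel. fourier_trunc R f \<xi> * cut S g \<xi>) \<longlongrightarrow> (LINT \<xi>|lborel. fourier f \<xi> * cut S g \<xi>)) at_top"
      by (intro L2_tendsto_integral_mult L2_fourier L2_cut L2_fourier_trunc sqnorm_fourier_trunc_tendsto f g)
    show "((\<lambda>R. LINT \<xi>|lborel. fourier_trunc R f \<xi> * cut S g \<xi>) \<longlongrightarrow> (LINT x|lborel. f x * fourier_trunc S g x)) at_top"
      unfolding eq
      by (intro L2_tendsto_integral_mult L2_fourier_trunc L2_cut sqnorm_cut_tendsto f g)
  qed simp
  then have eq2: "(LINT \<xi>|lborel. cut S g \<xi> * fourier f \<xi>) = (LINT x|lborel. fourier_trunc S g x * f x)" for S
    by (simp add: mult.commute)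
  have "(LINT \<xi>|lborel. g \<xi> * fourier f \<xi>) = (LINT x|lborel. fourier g x * f x)"
  proof (rule tendsto_unique)
    show "((\<lambda>S. LINT \<xi>|lborel. cut S g \<xi> * fourier f \<xi>) \<longlongrightarrow> (LINT \<xi>|lborel. g \<xi> * fourier f \<xi>)) at_top"
      by (intro L2_tendsto_integral_mult L2_fourier L2_cut sqnorm_cut_tendsto f g)
    show "((\<lambda>S. LINT \<xi>|lborel. cut S g \<xi> * fourier f \<xi>) \<longlongrightarrow> (LINT x|lborel. fourier g x * f x)) at_top"
      unfolding eq2
      by (intro L2_tendsto_integral_mult L2_fourier L2_fourier_trunc sqnorm_fourier_trunc_tendsto f g)
  qed simp
  then show ?thesis
    by (simp add: mult.commute)
qed

section \<open>Fourier inversion\<close>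

lemma AE_lborel_reflect:
  assumes "AE x in lborel. P (x::real)"
  shows "AE x in lborel. P (- x)"
  using AE_distrD[of uminus lborel borel P, unfolded lborel_distr_uminus] assms by simp

lemma AE_lborel_shift:
  assumes "AE x in lborel. P (x::real)"
  shows "AE x in lborel. P (a + x)"
  using AE_distrD[of "(+) a" lborel borel P, unfolded lborel_distr_plus] assms by simp

text \<open>Dynkin's argument: half lines form an intersection-stable generator of the Borel sets,
  and the sets over which f integrates to 0 are closed under complements, by \<open>total\<close>,
  and under countable disjoint unions.\<close>

lemma AE_eq_0_of_integrals_atMost_eq_0:
  fixes f :: "real \<Rightarrow> complex"
  assumes f: "integrable lborel f" and total: "(LINT x|lborel. f x) = 0"
    and half: "\<And>a. (LINT x:{..a}|lborel. f x) = 0"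
  shows "AE x in lborel. f x = 0"
proof (rule sigma_finite_measure.density_zero[OF sigma_finite_lborel f])
  fix A :: "real set" assume "A \<in> sets lborel"
  then have A: "A \<in> sigma_sets UNIV (range (\<lambda>a. {..a}))"
    by (simp add: borel_eq_atMost)
  have int: "set_integrable lborel A f" if "A \<in> sets borel" for A
    using f that unfolding set_integrable_def by (intro integrable_mult_indicator) auto
  have sets: "A \<in> sets borel" if "A \<in> sigma_sets UNIV (range (\<lambda>a::real. {..a}))" for A
    using that by (simp add: borel_eq_atMost)
  have "Int_stable (range (\<lambda>a::real. {..a}))"
    by (auto simp: Int_stable_def)
  moreover have "range (\<lambda>a::real. {..a}) \<subseteq> Pow UNIV" by simp
  ultimately show "(LINT x:A|lborel. f x) = 0" using A
  proof (induction rule: sigma_sets_induct_disjoint)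
    case (basic A)
    then show ?case using half by auto
  next
    case empty
    then show ?case by (simp add: set_lebesgue_integral_def)
  next
    case (compl A)
    have "(LINT x:A \<union> (UNIV - A)|lborel. f x) = (LINT x:A|lborel. f x) + (LINT x:UNIV - A|lborel. f x)"
      using sets[OF compl(1)] by (intro set_integral_Un int) auto
    then show ?case
      using compl(2) total by (simp add: set_lebesgue_integral_def)
  next
    case (union A)
    have "A i \<in> sets borel" for i
      using union(2) by (intro sets) auto
    then have "(LINT x:(\<Union>i. A i)|lborel. f x) = (\<Sum>i. (LINT x:A i|lborel. f x))"
      using union(1)
      by (intro lebesgue_integral_countable_add int sets.countable_UN) (auto simp: disjoint_family_on_def)
    then show ?case using union(3) by simp
  qed
qed

text \<open>Almost everywhere \<open>f - cut R f\<close> equals f, yet its norm tends to 0.\<close>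

lemma L2_AE_eq_0_if_cut_eq_0:
  assumes f: "f \<in> L2" and cut: "\<And>R. AE x in lborel. cut R f x = 0"
  shows "AE x in lborel. f x = 0"
proof -
  have [measurable]: "f \<in> borel_measurable borel" using f by measurable
  have "sqnorm (\<lambda>x. f x - cut R f x) = sqnorm f" for R
    using cut[of R] by (intro sqnorm_cong_AE) (auto elim: eventually_mono)
  then have "sqnorm f = 0"
    using sqnorm_cut_tendsto[OF f] by (simp add: tendsto_const_iff)
  then show ?thesis by (simp add: sqnorm_0_iff)
qed

lemma L2_AE_eq_0_of_interval_integrals:
  assumes f: "f \<in> L2" and zero: "\<And>a b. (LINT x|lborel. f x * indicator {a..b} x) = 0"
  shows "AE x in lborel. f x = 0"
proof (rule L2_AE_eq_0_if_cut_eq_0[OF f])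
  fix R
  show "AE x in lborel. cut R f x = 0"
  proof (rule AE_eq_0_of_integrals_atMost_eq_0[OF integrable_cut[OF f]])
    show "(LINT x|lborel. cut R f x) = 0"
      using zero[of "-R" R] by (simp add: cut_def mult.commute)
    fix a
    \<comment> \<open>A half line meets [-R, R] in an interval, which is empty when a < -R.\<close>
    have "(LINT x:{..a}|lborel. cut R f x) = (LINT x|lborel. f x * indicator {-R..min a R} x)"
      unfolding set_lebesgue_integral_def
      by (intro Bochner_Integration.integral_cong) (auto simp: cut_def indicator_def)
    then show "(LINT x:{..a}|lborel. cut R f x) = 0"
      using zero by simp
  qed
qed

text \<open>The substitution z = e t - y moves the parameter from the density into h, leaving a
  fixed integrable majorant for dominated convergence.\<close>

lemma gauss_average_eq:
  fixes h :: "real \<Rightarrow> complex"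
  assumes e: "e > 0"
  shows "(LINT z|lborel. h (- z) * of_real (normal_density 0 e (y + z))) =
    (LINT t|lborel. h (y - e * t) * of_real (std_normal_density t))"
proof -
  have nd: "e * normal_density 0 e (e * t) = std_normal_density t" for t
    using e by (simp add: normal_density_def real_sqrt_mult power_mult_distrib)
  have "(LINT z|lborel. h (- z) * of_real (normal_density 0 e (y + z))) =
     e *\<^sub>R (LINT t|lborel. h (y - e * t) * of_real (normal_density 0 e (e * t)))"
    using e lborel_integral_real_affine[of e "\<lambda>z. h (- z) * of_real (normal_density 0 e (y + z))" "- y"] by simp
  also have "\<dots> = (LINT t|lborel. h (y - e * t) * of_real (e * normal_density 0 e (e * t)))"
    by (subst integral_scaleR_right[symmetric]) (simp add: scaleR_conv_of_real mult_ac)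
  finally show ?thesis by (simp add: nd)
qed

lemma integrable_mult_std_normal:
  fixes h :: "real \<Rightarrow> complex"
  assumes [measurable]: "h \<in> borel_measurable borel" and h: "\<And>x. cmod (h x) \<le> 1"
  shows "integrable lborel (\<lambda>t. h t * of_real (std_normal_density t))"
  by (rule Bochner_Integration.integrable_bound[of lborel std_normal_density])
     (use h in \<open>auto simp: norm_mult intro!: mult_left_le_one_le\<close>)

lemma gauss_average_tendsto:
  fixes h :: "real \<Rightarrow> complex"
  assumes [measurable]: "h \<in> borel_measurable borel" and h: "\<And>x. cmod (h x) \<le> 1" and cont: "isCont h y"
  shows "(\<lambda>n. LINT t|lborel. h (y - inverse (real (Suc n)) * t) * of_real (std_normal_density t)) \<longlonglongrightarrow> h y"
proof -
  have "(\<lambda>n. LINT t|lborel. h (y - inverse (real (Suc n)) * t) * of_real (std_normal_density t)) \<longlonglongrightarrow>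
      (LINT t|lborel. h y * of_real (std_normal_density t))"
  proof (rule integral_dominated_convergence[where w = std_normal_density])
    show "AE t in lborel. (\<lambda>n. h (y - inverse (real (Suc n)) * t) * of_real (std_normal_density t))
        \<longlonglongrightarrow> h y * of_real (std_normal_density t)"
    proof (rule AE_I2)
      fix t
      have "(\<lambda>n. y - inverse (real (Suc n)) * t) \<longlonglongrightarrow> y - 0 * t"
        by (intro tendsto_intros LIMSEQ_inverse_real_of_nat)
      then have "(\<lambda>n. h (y - inverse (real (Suc n)) * t)) \<longlonglongrightarrow> h y"
        using cont by (auto intro: isCont_tendsto_compose)
      then show "(\<lambda>n. h (y - inverse (real (Suc n)) * t) * of_real (std_normal_density t))
        \<longlonglongrightarrow> h y * of_real (std_normal_density t)"
        by (intro tendsto_intros)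
    qed
    show "AE t in lborel. norm (h (y - inverse (real (Suc n)) * t) * of_real (std_normal_density t)) \<le> std_normal_density t" for n
      using h by (auto simp: norm_mult intro!: mult_left_le_one_le)
  qed auto
  then show ?thesis by simp
qed

lemma norm_gauss_average_le:
  fixes h :: "real \<Rightarrow> complex"
  assumes [measurable]: "h \<in> borel_measurable borel" and h: "\<And>x. cmod (h x) \<le> 1"
  shows "cmod (LINT t|lborel. h (y - e * t) * of_real (std_normal_density t)) \<le> 1"
proof -
  have "cmod (LINT t|lborel. h (y - e * t) * of_real (std_normal_density t)) \<le>
     (LINT t|lborel. cmod (h (y - e * t) * of_real (std_normal_density t)))"
    by (rule integral_norm_bound)
  also have "\<dots> \<le> (LINT t|lborel. std_normal_density t)"
    using h by (intro integral_mono integrable_norm integrable_mult_std_normal)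
      (auto simp: norm_mult intro!: mult_left_le_one_le)
  finally show ?thesis by simp
qed

lemma integrable_gauss_mult_ft:
  assumes "integrable lborel f" "e \<noteq> 0"
  shows "integrable lborel (\<lambda>\<xi>. of_real (gauss e \<xi>) * ft f \<xi>)"
proof (rule Bochner_Integration.integrable_bound)
  let ?B = "LINT x|lborel. cmod (f x)"
  show "integrable lborel (\<lambda>\<xi>. ?B * gauss e \<xi>)"
    using assms by (intro integrable_mult_right integrable_gauss)
  show "(\<lambda>\<xi>. of_real (gauss e \<xi>) * ft f \<xi>) \<in> borel_measurable lborel"
    using assms by measurable
  show "AE \<xi> in lborel. cmod (of_real (gauss e \<xi>) * ft f \<xi>) \<le> norm (?B * gauss e \<xi>)"
    using norm_ft_le[OF assms(1)] gauss_bounds(1)[of e]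
    by (auto simp: norm_mult abs_mult mult.commute less_imp_le intro!: mult_right_mono order_trans[OF _ abs_ge_self])
qed

text \<open>
  The test function is bounded and continuous almost everywhere, so its Gaussian averages converge
  boundedly and dominated convergence applies to a merely integrable \<open>f\<close>; density of continuous
  functions in \<open>L2\<close> is never needed.
\<close>

lemma integral_ft_mult_ft_reflect_interval:
  fixes h :: "real \<Rightarrow> complex" and a b :: real
  assumes f: "f \<in> L2" and int: "integrable lborel f"
  defines "h \<equiv> indicator {a..b}"
  shows "(LINT \<xi>|lborel. ft f \<xi> * ft (\<lambda>x. h (- x)) \<xi>) = 2 * pi * (LINT x|lborel. f x * h x)"
proof -
  have [measurable]: "f \<in> borel_measurable borel" "h \<in> borel_measurable borel"
    using f by (auto simp: h_def)
  have h1: "cmod (h x) \<le> 1" for x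
    by (simp add: h_def indicator_def)
  have L2h: "(\<lambda>x. h (- x)) \<in> L2"
    unfolding h_def by (intro L2_reflect L2_indicator) (auto simp: emeasure_lborel_Icc_eq)
  \<comment> \<open>The reflected interval lies within distance |a| + |b| of 0, so its indicator
    equals its own truncation and is integrable.\<close>
  have "(\<lambda>x. h (- x)) = cut (\<bar>a\<bar> + \<bar>b\<bar>) (\<lambda>x. h (- x))"
    by (auto simp: fun_eq_iff cut_def h_def indicator_def)
  then have inth: "integrable lborel (\<lambda>x. h (- x))"
    using integrable_cut[OF L2h] by metis
  define e where "e n = inverse (real (Suc n))" for n
  have e: "e n > 0" for n by (simp add: e_def)
  let ?c = "\<lambda>n y. LINT t|lborel. h (y - e n * t) * of_real (std_normal_density t)"
  have [measurable]: "?c n \<in> borel_measurable borel" for n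
    by measurable
  \<comment> \<open>The damped pairing has two limits. Removing the damping gives the left side of
    the claim; moving the transform by the multiplication formula first gives Gaussian averages of
    h, hence the right side.\<close>
  let ?I = "\<lambda>n. LINT \<xi>|lborel. ft f \<xi> * (of_real (gauss (e n) \<xi>) * ft (\<lambda>x. h (- x)) \<xi>)"
  have I: "?I n = 2 * pi * (LINT y|lborel. f y * ?c n y)" for n
  proof -
    have "?I n = (LINT y|lborel. f y * ft (\<lambda>\<xi>. of_real (gauss (e n) \<xi>) * ft (\<lambda>x. h (- x)) \<xi>) y)"
      using e[of n] by (intro ft_multiplication_formula int integrable_gauss_mult_ft inth) auto
    also have "\<dots> = (LINT y|lborel. 2 * pi * (f y * ?c n y))"
      by (simp add: ft_gauss_mult_ft[OF inth e] gauss_average_eq[OF e] mult_ac)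
    also have "\<dots> = 2 * pi * (LINT y|lborel. f y * ?c n y)"
      by (rule integral_mult_right_zero)
    finally show ?thesis .
  qed
  have "?I \<longlonglongrightarrow> (LINT \<xi>|lborel. ft f \<xi> * ft (\<lambda>x. h (- x)) \<xi>)"
  proof (rule integral_dominated_convergence[where w = "\<lambda>\<xi>. cmod (ft f \<xi> * ft (\<lambda>x. h (- x)) \<xi>)"])
    show "integrable lborel (\<lambda>\<xi>. cmod (ft f \<xi> * ft (\<lambda>x. h (- x)) \<xi>))"
      by (intro integrable_norm L2_mult_integrable L2_ft f int L2h inth)
    show "AE \<xi> in lborel. (\<lambda>n. ft f \<xi> * (of_real (gauss (e n) \<xi>) * ft (\<lambda>x. h (- x)) \<xi>))
        \<longlonglongrightarrow> ft f \<xi> * ft (\<lambda>x. h (- x)) \<xi>"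
    proof (rule AE_I2)
      fix \<xi>
      have "(\<lambda>n. ft f \<xi> * (complex_of_real (gauss (e n) \<xi>) * ft (\<lambda>x. h (- x)) \<xi>))
        \<longlonglongrightarrow> ft f \<xi> * (of_real 1 * ft (\<lambda>x. h (- x)) \<xi>)"
        unfolding e_def by (intro tendsto_intros gauss_tendsto_1)
      then show "(\<lambda>n. ft f \<xi> * (of_real (gauss (e n) \<xi>) * ft (\<lambda>x. h (- x)) \<xi>))
        \<longlonglongrightarrow> ft f \<xi> * ft (\<lambda>x. h (- x)) \<xi>"
        by simp
    qed
    show "AE \<xi> in lborel. cmod (ft f \<xi> * (of_real (gauss (e n) \<xi>) * ft (\<lambda>x. h (- x)) \<xi>))
       \<le> cmod (ft f \<xi> * ft (\<lambda>x. h (- x)) \<xi>)" for n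
    proof (rule AE_I2)
      fix \<xi>
      have "cmod (ft f \<xi> * (of_real (gauss (e n) \<xi>) * ft (\<lambda>x. h (- x)) \<xi>)) =
         gauss (e n) \<xi> * cmod (ft f \<xi> * ft (\<lambda>x. h (- x)) \<xi>)"
        using gauss_bounds(1)[of "e n" \<xi>] by (simp add: norm_mult)
      also have "\<dots> \<le> cmod (ft f \<xi> * ft (\<lambda>x. h (- x)) \<xi>)"
        using gauss_bounds[of "e n" \<xi>] by (intro mult_left_le_one_le) auto
      finally show "cmod (ft f \<xi> * (of_real (gauss (e n) \<xi>) * ft (\<lambda>x. h (- x)) \<xi>))
       \<le> cmod (ft f \<xi> * ft (\<lambda>x. h (- x)) \<xi>)" .
    qed
  qed measurable
  moreover have "?I \<longlonglongrightarrow> 2 * pi * (LINT x|lborel. f x * h x)"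
    unfolding I
  proof (intro tendsto_mult_left integral_dominated_convergence[where w = "\<lambda>y. cmod (f y)"])
    show "integrable lborel (\<lambda>y. cmod (f y))" using int by simp
    have "AE y in lborel. y \<noteq> a \<and> y \<noteq> b"
      using AE_lborel_singleton[of a] AE_lborel_singleton[of b] by eventually_elim auto
    then show "AE y in lborel. (\<lambda>n. f y * ?c n y) \<longlonglongrightarrow> f y * h y"
    proof eventually_elim
      case (elim y)
      have "isCont h y"
      proof -
        consider "y \<in> {a<..<b}" | "y \<in> - {a..b}" using elim by force
        then show ?thesis
        proof cases
          case 1
          have "\<forall>\<^sub>F x in nhds y. x \<in> {a<..<b}"
            using 1 by (intro eventually_nhds_in_open) auto
          then have "\<forall>\<^sub>F x in nhds y. h x = 1"
            by eventually_elim (auto simp: h_def)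
          then show ?thesis by (subst isCont_cong[of h "\<lambda>_. 1"]) auto
        next
          case 2
          have "\<forall>\<^sub>F x in nhds y. x \<in> - {a..b}"
            using 2 by (intro eventually_nhds_in_open) auto
          then have "\<forall>\<^sub>F x in nhds y. h x = 0"
            by eventually_elim (auto simp: h_def)
          then show ?thesis by (subst isCont_cong[of h "\<lambda>_. 0"]) auto
        qed
      qed
      then show ?case
        unfolding e_def by (intro tendsto_mult_left gauss_average_tendsto h1) auto
    qed
    show "AE y in lborel. cmod (f y * ?c n y) \<le> cmod (f y)" for n
      using norm_gauss_average_le[of h, OF _ h1]
      by (auto simp: norm_mult intro!: mult_right_le_one_le)
  qed measurable
  ultimately show ?thesis
    by (rule LIMSEQ_unique)
qed

text \<open>For integrable f and an interval indicator the single transforms are honest integrals,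
  so the interval identity above determines the pairing of the double transform with every
  interval.\<close>

lemma fourier_fourier_integrable:
  fixes f :: "real \<Rightarrow> complex"
  assumes f: "f \<in> L2" and int: "integrable lborel f"
  shows "AE x in lborel. fourier (fourier f) (- x) = 2 * pi * f x"
proof -
  have F: "fourier f \<in> L2" "fourier (fourier f) \<in> L2"
    using f by (auto intro: L2_fourier)
  have [measurable]: "f \<in> borel_measurable borel" "fourier f \<in> borel_measurable borel"
      "fourier (fourier f) \<in> borel_measurable borel"
    using f F by (auto intro: L2_measurable)
  have d: "(\<lambda>x. fourier (fourier f) (- x) - 2 * pi * f x) \<in> L2"
    by (intro L2_diff L2_reflect F L2_cmult f)
  have "AE x in lborel. fourier (fourier f) (- x) - 2 * pi * f x = 0"
  proof (rule L2_AE_eq_0_of_interval_integrals[OF d])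
    fix a b :: real
    let ?h = "\<lambda>x. indicator {a..b} x :: complex"
    have h: "?h \<in> L2"
      by (intro L2_indicator) (auto simp: emeasure_lborel_Icc_eq)
    have hr: "(\<lambda>x. ?h (- x)) \<in> L2" by (rule L2_reflect[OF h])
    have "(\<lambda>x. ?h (- x)) = cut (\<bar>a\<bar> + \<bar>b\<bar>) (\<lambda>x. ?h (- x))"
      by (auto simp: fun_eq_iff cut_def indicator_def)
    then have inth: "integrable lborel (\<lambda>x. ?h (- x))"
      using integrable_cut[OF hr] by metis
    have [measurable]: "fourier (\<lambda>x. ?h (- x)) \<in> borel_measurable borel"
        "ft (\<lambda>x. ?h (- x)) \<in> borel_measurable borel" "ft f \<in> borel_measurable borel"
      using fourier_measurable[OF hr] borel_measurable_ft[of f] borel_measurable_ft[of "\<lambda>x. ?h (- x)"] by simp_all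
    have "(LINT x|lborel. fourier (fourier f) (- x) * ?h x) = (LINT x|lborel. fourier (fourier f) x * ?h (- x))"
      by (subst lborel_integral_real_affine[of "-1" _ 0]) auto
    also have "\<dots> = (LINT x|lborel. fourier f x * fourier (\<lambda>x. ?h (- x)) x)"
      by (rule fourier_multiplication_formula[OF F(1) hr])
    also have "\<dots> = (LINT x|lborel. ft f x * ft (\<lambda>x. ?h (- x)) x)"
      using fourier_eq_ft[OF f int] fourier_eq_ft[OF hr inth]
      by (intro integral_cong_AE) (measurable, auto elim: eventually_elim2)
    also have "\<dots> = 2 * pi * (LINT x|lborel. f x * ?h x)"
      by (rule integral_ft_mult_ft_reflect_interval[OF f int])
    finally have "(LINT x|lborel. fourier (fourier f) (- x) * ?h x) = (LINT x|lborel. 2 * pi * (f x * ?h x))"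
      by simp
    moreover have "(LINT x|lborel. (fourier (fourier f) (- x) - 2 * pi * f x) * ?h x) =
       (LINT x|lborel. fourier (fourier f) (- x) * ?h x) - (LINT x|lborel. 2 * pi * (f x * ?h x))"
      using L2_mult_integrable[OF L2_reflect[OF F(2)] h] L2_mult_integrable[OF f h]
      by (subst Bochner_Integration.integral_diff[symmetric]) (auto simp: left_diff_distrib mult.assoc)
    ultimately show "(LINT x|lborel. (fourier (fourier f) (- x) - 2 * pi * f x) * ?h x) = 0"
      by simp
  qed
  then show ?thesis by simp
qed

text \<open>Duality: against a test function h in both spaces, the two transforms move onto the
  reflected h, where inversion is already known. Integrability of f is thus traded for integrability
  of the test function.\<close>

theorem fourier_fourier:
  fixes f :: "real \<Rightarrow> complex"
  assumes f: "f \<in> L2"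
  shows "AE x in lborel. fourier (fourier f) (- x) = 2 * pi * f x"
proof -
  have F: "fourier f \<in> L2" "fourier (fourier f) \<in> L2"
    using f by (auto intro: L2_fourier)
  define d where "d x = fourier (fourier f) (- x) - 2 * pi * f x" for x
  have d: "d \<in> L2"
    unfolding d_def by (intro L2_diff L2_reflect F L2_cmult f)
  have zero: "(LINT x|lborel. d x * h x) = 0" if h: "h \<in> L2" "integrable lborel h" for h
  proof -
    have hr: "(\<lambda>x. h (- x)) \<in> L2" by (rule L2_reflect[OF h(1)])
    have intr: "integrable lborel (\<lambda>x. h (- x))"
      using lborel_integrable_real_affine[OF h(2), of "-1" 0] by simp
    have FF: "AE x in lborel. fourier (fourier (\<lambda>x. h (- x))) x = 2 * pi * h x"
      using AE_lborel_reflect[OF fourier_fourier_integrable[OF hr intr]] by simp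
    have [measurable]: "f \<in> borel_measurable borel" "h \<in> borel_measurable borel"
       "fourier (fourier (\<lambda>x. h (- x))) \<in> borel_measurable borel"
      using f h hr by (auto intro: L2_measurable L2_fourier)
    have "(LINT x|lborel. fourier (fourier f) (- x) * h x) = (LINT x|lborel. fourier (fourier f) x * h (- x))"
      by (subst lborel_integral_real_affine[of "-1" _ 0]) auto
    also have "\<dots> = (LINT x|lborel. f x * fourier (fourier (\<lambda>x. h (- x))) x)"
      using f hr by (simp add: fourier_multiplication_formula F L2_fourier)
    also have "\<dots> = (LINT x|lborel. 2 * pi * (f x * h x))"
      using FF by (intro integral_cong_AE) (measurable, auto elim: eventually_mono)
    finally have "(LINT x|lborel. fourier (fourier f) (- x) * h x) = (LINT x|lborel. 2 * pi * (f x * h x))" .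
    moreover have "(LINT x|lborel. d x * h x) =
       (LINT x|lborel. fourier (fourier f) (- x) * h x) - (LINT x|lborel. 2 * pi * (f x * h x))"
      using L2_mult_integrable[OF L2_reflect[OF F(2)] h(1)] L2_mult_integrable[OF f h(1)]
      by (subst Bochner_Integration.integral_diff[symmetric]) (auto simp: left_diff_distrib mult.assoc d_def)
    ultimately show ?thesis by simp
  qed
  have "AE x in lborel. d x = 0"
  proof (rule L2_AE_eq_0_if_cut_eq_0[OF d])
    fix R
    \<comment> \<open>Testing with the conjugate of \<open>cut R d\<close> turns the integral into
      the squared norm of \<open>cut R d\<close>.\<close>
    have cd: "(\<lambda>x. cnj (cut R d x)) \<in> L2" "integrable lborel (\<lambda>x. cnj (cut R d x))"
      by (intro L2_cnj L2_cut d) (use integrable_cut[OF d] in auto)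
    have [measurable]: "d \<in> borel_measurable borel" using d by measurable
    have "complex_of_real (LINT x|lborel. (cmod (cut R d x))\<^sup>2) = (LINT x|lborel. d x * cnj (cut R d x))"
      unfolding Bochner_Integration.integral_complex_of_real[symmetric]
      by (intro Bochner_Integration.integral_cong)
         (auto simp: cut_def indicator_def complex_norm_square[unfolded of_real_power])
    also have "\<dots> = 0" by (rule zero[OF cd])
    finally have "sqnorm (cut R d) = 0"
      using sqnorm_eq_integral[OF L2_cut[OF d]] by simp
    then show "AE x in lborel. cut R d x = 0"
      by (simp add: sqnorm_0_iff)
  qed
  then show ?thesis by (simp add: d_def)
qed

section \<open>Hardy spaces and the projector\<close>

lemma inv_fourier_eq: "inv_fourier g = (\<lambda>x. 1 / (2 * of_real pi) * fourier g (- x))"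
  by (simp add: inv_fourier_def fun_eq_iff)

lemma L2_inv_fourier: "g \<in> L2 \<Longrightarrow> inv_fourier g \<in> L2"
  unfolding inv_fourier_eq by (intro L2_cmult L2_reflect L2_fourier)

lemma inv_fourier_fourier:
  assumes "f \<in> L2"
  shows "AE x in lborel. inv_fourier (fourier f) x = f x"
  using fourier_fourier[OF assms] by eventually_elim (simp add: inv_fourier_def)

lemma fourier_inv_fourier:
  assumes g: "g \<in> L2"
  shows "AE \<xi> in lborel. fourier (inv_fourier g) \<xi> = g \<xi>"
  using fourier_cmult[OF L2_reflect[OF L2_fourier[OF g]], of "1 / (2 * of_real pi)"]
    fourier_reflect[OF L2_fourier[OF g]] fourier_fourier[OF g]
  by eventually_elim (simp add: inv_fourier_eq)

lemma inv_fourier_cong_AE: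
  assumes "f \<in> borel_measurable borel" "g \<in> borel_measurable borel" "AE x in lborel. f x = g x"
  shows "inv_fourier f = inv_fourier g"
  using fourier_cong_AE[OF assms] by (simp add: inv_fourier_eq)

lemma inv_fourier_add:
  assumes "f \<in> L2" "g \<in> L2"
  shows "AE x in lborel. inv_fourier (\<lambda>\<xi>. f \<xi> + g \<xi>) x = inv_fourier f x + inv_fourier g x"
  using AE_lborel_reflect[OF fourier_add[OF assms]]
  by eventually_elim (simp add: inv_fourier_def distrib_left)

lemma inv_fourier_cmult:
  assumes "f \<in> L2"
  shows "AE x in lborel. inv_fourier (\<lambda>\<xi>. c * f \<xi>) x = c * inv_fourier f x"
  using AE_lborel_reflect[OF fourier_cmult[OF assms]]
  by eventually_elim (simp add: inv_fourier_def)

lemma inv_fourier_zero: "AE x in lborel. inv_fourier (\<lambda>\<xi>. 0) x = 0"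
  using inv_fourier_cmult[OF L2_zero, of 0] by simp

lemma inv_fourier_eq_ft:
  assumes "g \<in> L2" "integrable lborel g"
  shows "AE x in lborel. inv_fourier g x = 1 / (2 * of_real pi) * ft g (- x)"
  using AE_lborel_reflect[OF fourier_eq_ft[OF assms]]
  by eventually_elim (simp add: inv_fourier_def)

text \<open>The conjugate of \<open>fourier g\<close> is the transform of x \<mapsto> cnj (g (-x)).
  The multiplication formula then leaves the double transform of f, which inversion
  evaluates.\<close>

theorem fourier_parseval:
  assumes f: "f \<in> L2" and g: "g \<in> L2"
  shows "(LINT \<xi>|lborel. fourier f \<xi> * cnj (fourier g \<xi>)) = 2 * pi * (LINT x|lborel. f x * cnj (g x))"
proof -
  have gr: "(\<lambda>x. cnj (g (- x))) \<in> L2" by (intro L2_cnj L2_reflect g)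
  have [measurable]: "f \<in> borel_measurable borel" "g \<in> borel_measurable borel" "fourier f \<in> borel_measurable borel"
      "fourier g \<in> borel_measurable borel" "fourier (fourier f) \<in> borel_measurable borel"
      "fourier (\<lambda>x. cnj (g (- x))) \<in> borel_measurable borel"
    using f g gr by (auto intro: L2_measurable L2_fourier)
  have eq: "AE \<xi> in lborel. cnj (fourier g \<xi>) = fourier (\<lambda>x. cnj (g (- x))) \<xi>"
    using fourier_reflect[OF L2_cnj[OF g]] AE_lborel_reflect[OF fourier_cnj[OF g]]
    by eventually_elim simp
  have "(LINT \<xi>|lborel. fourier f \<xi> * cnj (fourier g \<xi>)) = (LINT \<xi>|lborel. fourier f \<xi> * fourier (\<lambda>x. cnj (g (- x))) \<xi>)"
    using eq by (intro integral_cong_AE) (measurable, auto elim: eventually_mono)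
  also have "\<dots> = (LINT x|lborel. fourier (fourier f) x * cnj (g (- x)))"
    by (rule fourier_multiplication_formula[symmetric]) (intro L2_fourier f gr)+
  also have "\<dots> = (LINT x|lborel. fourier (fourier f) (- x) * cnj (g x))"
    by (subst lborel_integral_real_affine[of "-1" _ 0]) auto
  also have "\<dots> = (LINT x|lborel. 2 * pi * (f x * cnj (g x)))"
    using fourier_fourier[OF f] by (intro integral_cong_AE) (measurable, auto elim: eventually_mono)
  also have "\<dots> = 2 * pi * (LINT x|lborel. f x * cnj (g x))"
    by (rule integral_mult_right_zero)
  finally show ?thesis .
qed

text \<open>The support removes a possibly uncountable union of open sets, on each of which f
  vanishes almost everywhere. The Lindelof property reduces it to a countable union, so the
  exceptional null sets can be collected.\<close>

lemma ess_support_subset_atLeast_iff: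
  "ess_support f \<subseteq> {0..} \<longleftrightarrow> (AE x in lborel. x < 0 \<longrightarrow> f x = 0)"
proof
  let ?U = "{U. open U \<and> (AE x in lborel. x \<in> U \<longrightarrow> f x = 0)}"
  assume "ess_support f \<subseteq> {0..}"
  then have "- {0..} \<subseteq> - ess_support f"
    by blast
  moreover have "- ess_support f = \<Union>?U"
    by (simp only: ess_support_def double_complement)
  ultimately have sub: "- {0..} \<subseteq> \<Union>?U"
    by (simp only:)
  obtain V where V: "V \<subseteq> ?U" "countable V" "\<Union>V = \<Union>?U"
    using Lindelof[of ?U] by (metis (no_types, lifting) mem_Collect_eq)
  then have "AE x in lborel. \<forall>U\<in>V. x \<in> U \<longrightarrow> f x = 0"
    by (subst AE_ball_countable) auto
  then show "AE x in lborel. x < 0 \<longrightarrow> f x = 0"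
  proof eventually_elim
    case (elim x)
    show ?case
    proof
      assume "x < 0"
      then have "x \<in> \<Union>V"
        unfolding V(3) by (intro subsetD[OF sub]) simp
      then show "f x = 0" using elim by blast
    qed
  qed
next
  assume "AE x in lborel. x < 0 \<longrightarrow> f x = 0"
  then have "{..<0} \<in> {U. open U \<and> (AE x in lborel. x \<in> U \<longrightarrow> f x = 0)}"
    by auto
  then have "{..<0} \<subseteq> \<Union>{U. open U \<and> (AE x in lborel. x \<in> U \<longrightarrow> f x = 0)}"
    by blast
  then have "- \<Union>{U. open U \<and> (AE x in lborel. x \<in> U \<longrightarrow> f x = 0)} \<subseteq> - {..<0}"
    by (rule Compl_anti_mono)
  then show "ess_support f \<subseteq> {0..}"
    unfolding ess_support_def by (simp add: Compl_lessThan)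
qed

lemma H_plus_D:
  assumes "f \<in> H_plus \<sigma>"
  shows "f \<in> L2" "AE \<xi> in lborel. \<xi> < 0 \<longrightarrow> fourier f \<xi> = 0"
    "integrable lborel (\<lambda>\<xi>. (1 + \<xi>\<^sup>2) powr \<sigma> * (cmod (fourier f \<xi>))\<^sup>2)"
  using assms by (auto simp: H_plus_def H_space_def ess_support_subset_atLeast_iff)

lemma integrable_inverse_1_plus_square_lborel: "integrable lborel (\<lambda>x::real. inverse (1 + x\<^sup>2))"
  using integrable_inverse_1_plus_square by (simp add: set_integrable_def)

text \<open>The Sobolev embedding in one dimension: the transform is integrable, and inversion
  bounds u by its integral. It makes multiplication by u a bounded operation on
  \<open>L2\<close>.\<close>

lemma H_plus_1_bounded:
  assumes u: "u \<in> H_plus 1"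
  shows "\<exists>B. AE x in lborel. cmod (u x) \<le> B"
proof -
  note u = H_plus_D[OF u]
  have F: "fourier u \<in> L2" by (rule L2_fourier[OF u(1)])
  have int: "integrable lborel (fourier u)"
  proof (rule Bochner_Integration.integrable_bound)
    show "integrable lborel (\<lambda>\<xi>. (1 + \<xi>\<^sup>2) powr 1 * (cmod (fourier u \<xi>))\<^sup>2 + inverse (1 + \<xi>\<^sup>2))"
      by (intro Bochner_Integration.integrable_add u integrable_inverse_1_plus_square_lborel)
    show "fourier u \<in> borel_measurable lborel" using F by measurable
    show "AE \<xi> in lborel. norm (fourier u \<xi>) \<le> norm ((1 + \<xi>\<^sup>2) powr 1 * (cmod (fourier u \<xi>))\<^sup>2 + inverse (1 + \<xi>\<^sup>2))"
    proof (rule AE_I2)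
      fix \<xi> :: real
      define p where "p = 1 + \<xi>\<^sup>2"
      have p: "p > 0" by (simp add: p_def add_pos_nonneg)
      \<comment> \<open>Inserting sqrt p / sqrt p = 1 and using a b \<le> a^2 + b^2 leaves the H^1
        integrand plus 1 / p.\<close>
      let ?a = "sqrt p * cmod (fourier u \<xi>)" and ?b = "inverse (sqrt p)"
      have "cmod (fourier u \<xi>) = ?a * ?b" using p by simp
      also have "\<dots> \<le> ?a\<^sup>2 + ?b\<^sup>2"
      proof -
        have "0 \<le> ?a * ?b" using p by simp
        then show ?thesis using sum_squares_bound[of ?a ?b] by linarith
      qed
      also have "\<dots> = p * (cmod (fourier u \<xi>))\<^sup>2 + inverse p"
        using p by (simp add: power_mult_distrib power_inverse)
      finally show "norm (fourier u \<xi>) \<le> norm ((1 + \<xi>\<^sup>2) powr 1 * (cmod (fourier u \<xi>))\<^sup>2 + inverse (1 + \<xi>\<^sup>2))"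
        unfolding p_def[symmetric] using p by simp
    qed
  qed
  have "AE x in lborel. cmod (u x) \<le> 1 / (2 * pi) * (LINT \<xi>|lborel. cmod (fourier u \<xi>))"
    using inv_fourier_fourier[OF u(1)] inv_fourier_eq_ft[OF F int]
  proof eventually_elim
    case (elim x)
    then have "cmod (u x) = 1 / (2 * pi) * cmod (ft (fourier u) (- x))"
      by (metis norm_mult norm_divide norm_of_real norm_one norm_numeral abs_of_pos pi_gt_zero)
    also have "\<dots> \<le> 1 / (2 * pi) * (LINT \<xi>|lborel. cmod (fourier u \<xi>))"
      by (intro mult_left_mono norm_ft_le int) auto
    finally show ?case .
  qed
  then show ?thesis by blast
qed

section \<open>The projector\<close>

lemma L2_half_line: "f \<in> L2 \<Longrightarrow> (\<lambda>\<xi>. complex_of_real (indicator {0..} \<xi>) * f \<xi>) \<in> L2"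
  by (rule L2_mult_bounded[where B = 1]) (auto simp: indicator_def)

lemma L2_szego: "f \<in> L2 \<Longrightarrow> szego f \<in> L2"
  unfolding szego_def by (intro L2_inv_fourier L2_half_line L2_fourier)

lemma fourier_szego:
  "f \<in> L2 \<Longrightarrow> AE \<xi> in lborel. fourier (szego f) \<xi> = of_real (indicator {0..} \<xi>) * fourier f \<xi>"
  unfolding szego_def by (intro fourier_inv_fourier L2_half_line L2_fourier)

text \<open>Conjugation reflects the spectrum into (-\<infinity>, 0]. At \<xi> = 0 the indicator is
  1 and nothing is known about the transform, so this point is discarded as a null set.\<close>

lemma fourier_cnj_H_plus:
  assumes u: "u \<in> H_plus \<sigma>"
  shows "AE \<xi> in lborel. complex_of_real (indicator {0..} \<xi>) * fourier (\<lambda>x. cnj (u x)) \<xi> = 0"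
  using fourier_cnj[OF H_plus_D(1)[OF u]] AE_lborel_reflect[OF H_plus_D(2)[OF u]] AE_lborel_singleton[of "0::real"]
  by eventually_elim (auto simp: indicator_def)

lemma szego_cnj_H_plus:
  assumes u: "u \<in> H_plus \<sigma>"
  shows "AE x in lborel. szego (\<lambda>x. cnj (u x)) x = 0"
proof -
  have [measurable]: "fourier (\<lambda>x. cnj (u x)) \<in> borel_measurable borel"
    by (intro fourier_measurable L2_cnj H_plus_D(1)[OF u])
  have "szego (\<lambda>x. cnj (u x)) = inv_fourier (\<lambda>\<xi>. 0)"
    unfolding szego_def by (intro inv_fourier_cong_AE fourier_cnj_H_plus[OF u]) measurable
  then show ?thesis
    using inv_fourier_zero by simp
qed

text \<open>The transform of the product is a convolution of functions supported in \<open>[0, \<infinity>)\<close>.\<close>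

lemma ft_mult_eq_0:
  assumes u: "u \<in> L2" "AE \<xi> in lborel. \<xi> < 0 \<longrightarrow> fourier u \<xi> = 0"
    and v: "v \<in> L2" "AE \<xi> in lborel. \<xi> < 0 \<longrightarrow> fourier v \<xi> = 0"
    and \<xi>: "\<xi> < 0"
  shows "ft (\<lambda>x. u x * v x) \<xi> = 0"
proof -
  define U where "U = (\<lambda>x. exp (- (\<i> * of_real (x * \<xi>))) * u x)"
  have U: "U \<in> L2" unfolding U_def by (intro L2_modulate u)
  \<comment> \<open>V is the inverse transform of v; it vanishes almost everywhere on \<eta> > 0
    because v has nonnegative spectrum.\<close>
  define V where "V = (\<lambda>\<eta>. 1 / (2 * of_real pi) * fourier v (- \<eta>))"
  have V: "V \<in> L2" unfolding V_def by (intro L2_cmult L2_reflect L2_fourier v)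
  have [measurable]: "U \<in> borel_measurable borel" "V \<in> borel_measurable borel" "v \<in> borel_measurable borel"
     "fourier U \<in> borel_measurable borel" "fourier V \<in> borel_measurable borel"
    using U V v by (auto intro: L2_measurable L2_fourier)
  have FV: "AE x in lborel. fourier V x = v x"
    using fourier_cmult[OF L2_reflect[OF L2_fourier[OF v(1)]], of "1 / (2 * of_real pi)"]
      fourier_reflect[OF L2_fourier[OF v(1)]] fourier_fourier[OF v(1)]
    unfolding V_def by eventually_elim simp
  have FU: "AE \<eta> in lborel. fourier U \<eta> = fourier u (\<xi> + \<eta>)"
    unfolding U_def by (rule fourier_modulate[OF u(1)])
  have "ft (\<lambda>x. u x * v x) \<xi> = (LINT x|lborel. U x * v x)"
    unfolding ft_def U_def by (simp add: mult_ac)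
  also have "\<dots> = (LINT x|lborel. U x * fourier V x)"
    using FV by (intro integral_cong_AE) (measurable, auto elim: eventually_mono)
  also have "\<dots> = (LINT \<eta>|lborel. fourier U \<eta> * V \<eta>)"
    by (rule fourier_multiplication_formula[OF U V, symmetric])
  also have "\<dots> = integral\<^sup>L lborel (\<lambda>\<eta>::real. 0)"
  proof (intro integral_cong_AE)
    show "AE \<eta> in lborel. fourier U \<eta> * V \<eta> = 0"
      using FU AE_lborel_shift[OF u(2), of \<xi>] AE_lborel_reflect[OF v(2)]
    proof eventually_elim
      case (elim \<eta>)
      \<comment> \<open>For \<eta> > 0 the factor V vanishes; for \<eta> \<le> 0 the shifted
        argument \<xi> + \<eta> is negative and \<open>fourier u\<close> vanishes there.\<close>
      then show ?case using \<xi> by (cases "\<eta> > 0") (auto simp: V_def)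
    qed
  qed measurable
  finally show ?thesis by simp
qed

text \<open>For each x the convolution integral pairs f with a translate of
  \<open>fourier g\<close>, that is, with the transform of a modulated g. The multiplication formula
  turns it into the inverse Fourier integral at x, for every x; null sets enter only through the
  representative in \<open>inv_fourier\<close>. The bound on g puts the product in
  \<open>L2\<close>.\<close>

lemma convolution_inv_fourier:
  assumes g: "g \<in> L2" and f: "f \<in> L2" and bound: "\<And>\<xi>. cmod (g \<xi>) \<le> B"
  shows "AE x in lborel. Defs.convolution (inv_fourier g) f x = inv_fourier (\<lambda>\<xi>. g \<xi> * fourier f \<xi>) x"
proof -
  have F: "fourier f \<in> L2" by (rule L2_fourier[OF f])
  have [measurable]: "f \<in> borel_measurable borel" "fourier f \<in> borel_measurable borel"
      "g \<in> borel_measurable borel" "fourier g \<in> borel_measurable borel"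
    using f g F by (auto intro: L2_measurable L2_fourier)
  have gF: "(\<lambda>\<xi>. g \<xi> * fourier f \<xi>) \<in> L2"
    by (rule L2_mult_bounded[OF F _ AE_I2[OF bound]]) measurable
  have "Defs.convolution (inv_fourier g) f x = 1 / (2 * of_real pi) * ft (\<lambda>\<xi>. g \<xi> * fourier f \<xi>) (- x)" for x
  proof -
    let ?g = "\<lambda>\<xi>. exp (- (\<i> * of_real (\<xi> * (- x)))) * g \<xi>"
    have Lg: "?g \<in> L2" by (rule L2_modulate[OF g])
    have [measurable]: "fourier ?g \<in> borel_measurable borel" by (rule fourier_measurable[OF Lg])
    have "Defs.convolution (inv_fourier g) f x = (LINT y|lborel. 1 / (2 * of_real pi) * (fourier g (- x + y) * f y))"
      unfolding Defs.convolution_def inv_fourier_def by (simp add: mult.assoc)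
    also have "\<dots> = 1 / (2 * of_real pi) * (LINT y|lborel. fourier g (- x + y) * f y)"
      by (rule integral_mult_right_zero)
    also have "(LINT y|lborel. fourier g (- x + y) * f y) = (LINT y|lborel. fourier ?g y * f y)"
      using fourier_modulate[OF g, of "- x"] by (intro integral_cong_AE) (measurable, auto elim: eventually_mono)
    also have "\<dots> = (LINT \<xi>|lborel. ?g \<xi> * fourier f \<xi>)"
      by (rule fourier_multiplication_formula[OF Lg f])
    also have "\<dots> = ft (\<lambda>\<xi>. g \<xi> * fourier f \<xi>) (- x)"
      unfolding ft_def by (simp add: mult_ac)
    finally show ?thesis .
  qed
  then show ?thesis
    using inv_fourier_eq_ft[OF gF L2_mult_integrable[OF g F]] by (auto elim: eventually_mono)
qed

section \<open>The Lax operator and the integral equation\<close>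

text \<open>With m = |\<xi> - k|, the inequality \<xi> \<le> m + |k| bounds \<xi>^2 by 2 m^2 + 2
  |k|^2. The terms free of m are absorbed using m^2 / d^2 \<ge> 1, which is the origin of the
  constant.\<close>

lemma resolvent_symbol_bound:
  assumes d: "d > 0" "\<And>\<xi>. \<xi> \<ge> 0 \<Longrightarrow> d \<le> cmod (of_real \<xi> - k)"
  shows "(cmod (complex_of_real (indicator {0..} \<xi>) / (of_real \<xi> - k)))\<^sup>2
    \<le> ((1 + 2 * (cmod k)\<^sup>2) / d\<^sup>2 + 2) * inverse (1 + \<xi>\<^sup>2)"
proof (cases "\<xi> \<ge> 0")
  case True
  define m where "m = cmod (of_real \<xi> - k)"
  have m: "d \<le> m" using d(2)[OF True] by (simp add: m_def)
  have "\<xi> \<le> m + cmod k"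
    using norm_triangle_ineq[of "of_real \<xi> - k" k] True by (simp add: m_def)
  then have "\<xi>\<^sup>2 \<le> (m + cmod k)\<^sup>2"
    using True by (intro power_mono)
  also have "\<dots> \<le> 2 * m\<^sup>2 + 2 * (cmod k)\<^sup>2"
    using sum_squares_bound[of m "cmod k"] by (simp add: power2_sum)
  finally have "1 + \<xi>\<^sup>2 \<le> (1 + 2 * (cmod k)\<^sup>2) * 1 + 2 * m\<^sup>2"
    by simp
  also have "\<dots> \<le> (1 + 2 * (cmod k)\<^sup>2) * (m\<^sup>2 / d\<^sup>2) + 2 * m\<^sup>2"
    using m d(1) by (intro add_mono mult_left_mono) (auto simp: divide_simps intro!: power_mono)
  also have "\<dots> = ((1 + 2 * (cmod k)\<^sup>2) / d\<^sup>2 + 2) * m\<^sup>2"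
    by (simp add: algebra_simps add_divide_distrib)
  finally have "1 + \<xi>\<^sup>2 \<le> ((1 + 2 * (cmod k)\<^sup>2) / d\<^sup>2 + 2) * m\<^sup>2" .
  moreover have "1 + \<xi>\<^sup>2 > 0" by (simp add: add_pos_nonneg)
  moreover have "m > 0" using m d by simp
  ultimately have "inverse (m\<^sup>2) \<le> ((1 + 2 * (cmod k)\<^sup>2) / d\<^sup>2 + 2) * inverse (1 + \<xi>\<^sup>2)"
    by (subst inverse_eq_divide, subst pos_divide_le_eq) (auto simp: field_simps)
  then show ?thesis
    using True by (simp add: norm_divide power_divide m_def inverse_eq_divide)
next
  case False
  have "0 \<le> ((1 + 2 * (cmod k)\<^sup>2) / d\<^sup>2 + 2) * inverse (1 + \<xi>\<^sup>2)"
    by (intro mult_nonneg_nonneg add_nonneg_nonneg divide_nonneg_nonneg) auto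
  then show ?thesis using False by (simp add: indicator_def)
qed

lemma resolvent_symbol_L2:
  assumes d: "d > 0" "\<And>\<xi>. \<xi> \<ge> 0 \<Longrightarrow> d \<le> cmod (of_real \<xi> - k)"
  shows "(\<lambda>\<xi>. complex_of_real (indicator {0..} \<xi>) / (of_real \<xi> - k)) \<in> L2"
proof -
  have "integrable lborel (\<lambda>\<xi>. (cmod (complex_of_real (indicator {0..} \<xi>) / (of_real \<xi> - k)))\<^sup>2)"
  proof (rule Bochner_Integration.integrable_bound)
    show "integrable lborel (\<lambda>\<xi>. ((1 + 2 * (cmod k)\<^sup>2) / d\<^sup>2 + 2) * inverse (1 + \<xi>\<^sup>2))"
      by (intro integrable_mult_right integrable_inverse_1_plus_square_lborel)
    show "AE \<xi> in lborel. norm ((cmod (complex_of_real (indicator {0..} \<xi>) / (of_real \<xi> - k)))\<^sup>2)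
        \<le> norm (((1 + 2 * (cmod k)\<^sup>2) / d\<^sup>2 + 2) * inverse (1 + \<xi>\<^sup>2))"
      unfolding real_norm_def abs_power2
      by (intro AE_I2 order_trans[OF resolvent_symbol_bound[OF d] abs_ge_self])
  qed measurable
  then show ?thesis by (simp add: L2_def)
qed

lemma resolvent_symbol_bounded:
  assumes d: "d > 0" "\<And>\<xi>. \<xi> \<ge> 0 \<Longrightarrow> d \<le> cmod (of_real \<xi> - k)"
  shows "cmod (complex_of_real (indicator {0..} \<xi>) / (of_real \<xi> - k)) \<le> 1 / d"
  using d(1) d(2)[of \<xi>] by (auto simp: indicator_def norm_divide intro!: frac_le)

section \<open>Eigenvalues of the Lax operator\<close>

lemma L2_fourier_multiplier_H_space_1:
  assumes h: "h \<in> L2" and int: "integrable lborel (\<lambda>\<xi>. (1 + \<xi>\<^sup>2) powr 1 * (cmod (fourier h \<xi>))\<^sup>2)"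
  shows "(\<lambda>\<xi>. of_real \<xi> * fourier h \<xi>) \<in> L2"
proof -
  have [measurable]: "fourier h \<in> borel_measurable borel" by (rule fourier_measurable[OF h])
  have "integrable lborel (\<lambda>\<xi>. (cmod (of_real \<xi> * fourier h \<xi>))\<^sup>2)"
    by (rule Bochner_Integration.integrable_bound[OF int])
       (auto simp: norm_mult power_mult_distrib abs_mult intro!: mult_right_mono)
  then show ?thesis by (simp add: L2_def)
qed

text \<open>The quadratic form of the Lax operator is real.\<close>

lemma sigma_pp_real:
  assumes u: "u \<in> H_plus 1" and \<mu>: "\<mu> \<in> sigma_pp u"
  shows "Im \<mu> = 0"
proof -
  obtain h where hH: "h \<in> H_plus 1" and nz: "\<not> (AE x in lborel. h x = 0)"
    and eig: "AE x in lborel. lax u h x = \<mu> * h x"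
    using \<mu> by (auto simp: sigma_pp_def)
  note h = H_plus_D[OF hH]
  obtain B where B: "AE x in lborel. cmod (u x) \<le> B"
    using H_plus_1_bounded[OF u] by blast
  have uL2: "u \<in> L2" using H_plus_D(1)[OF u] .
  define p where "p = (\<lambda>x. cnj (u x) * h x)"
  have p: "p \<in> L2"
    unfolding p_def using B by (intro L2_mult_bounded[OF h(1), of _ B]) (use uL2 in \<open>auto intro: L2_measurable L2_cnj\<close>)
  define q where "q = (\<lambda>x. u x * szego p x)"
  have q: "q \<in> L2"
    unfolding q_def using B by (intro L2_mult_bounded[OF L2_szego[OF p], of _ B]) (use uL2 in \<open>auto intro: L2_measurable\<close>)
  define D where "D = (\<lambda>x. - \<i> * deriv_L2 h x)"
  have xi: "(\<lambda>\<xi>. \<i> * of_real \<xi> * fourier h \<xi>) \<in> L2"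
    using L2_cmult[OF L2_fourier_multiplier_H_space_1[OF h(1,3)], of \<i>] by (simp add: mult.assoc)
  have deriv: "deriv_L2 h \<in> L2"
    unfolding deriv_L2_def by (rule L2_inv_fourier[OF xi])
  have D: "D \<in> L2" unfolding D_def by (rule L2_cmult[OF deriv])
  have [measurable]: "u \<in> borel_measurable borel" "h \<in> borel_measurable borel" "p \<in> borel_measurable borel"
     "q \<in> borel_measurable borel" "D \<in> borel_measurable borel" "szego p \<in> borel_measurable borel"
     "fourier h \<in> borel_measurable borel" "fourier D \<in> borel_measurable borel" "fourier p \<in> borel_measurable borel"
     "fourier (szego p) \<in> borel_measurable borel"
    using uL2 h p q D by (auto intro: L2_measurable L2_szego L2_fourier)
  have FD: "AE \<xi> in lborel. fourier D \<xi> = of_real \<xi> * fourier h \<xi>"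
    using fourier_cmult[OF deriv, of "- \<i>"] fourier_inv_fourier[OF xi]
    unfolding D_def deriv_L2_def[symmetric] by eventually_elim (simp add: mult.assoc[symmetric])
  \<comment> \<open>On the Fourier side the differential part is multiplication by the real symbol
    \<xi>.\<close>
  have "2 * pi * (LINT x|lborel. D x * cnj (h x)) = (LINT \<xi>|lborel. fourier D \<xi> * cnj (fourier h \<xi>))"
    by (rule fourier_parseval[OF D h(1), symmetric])
  also have "\<dots> = (LINT \<xi>|lborel. complex_of_real (\<xi> * (cmod (fourier h \<xi>))\<^sup>2))"
    using FD by (intro integral_cong_AE)
      (measurable, auto elim!: eventually_mono simp: complex_norm_square[unfolded of_real_power])
  also have "\<dots> = of_real (LINT \<xi>|lborel. \<xi> * (cmod (fourier h \<xi>))\<^sup>2)"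
    by (rule Bochner_Integration.integral_complex_of_real)
  finally have 1: "Im (LINT x|lborel. D x * cnj (h x)) = 0"
    by (auto simp: complex_eq_iff)
  \<comment> \<open>Since u * cnj h = cnj p, the potential part is the pairing of
    \<open>szego p\<close> with p, and the symbol of the projector is again real.\<close>
  have "2 * pi * (LINT x|lborel. q x * cnj (h x)) = 2 * pi * (LINT x|lborel. szego p x * cnj (p x))"
    by (simp add: q_def p_def mult_ac)
  also have "\<dots> = (LINT \<xi>|lborel. fourier (szego p) \<xi> * cnj (fourier p \<xi>))"
    by (rule fourier_parseval[OF L2_szego[OF p] p, symmetric])
  also have "\<dots> = (LINT \<xi>|lborel. complex_of_real (indicator {0..} \<xi> * (cmod (fourier p \<xi>))\<^sup>2))"
    using fourier_szego[OF p] by (intro integral_cong_AE)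
      (measurable, auto elim!: eventually_mono simp: complex_norm_square[unfolded of_real_power])
  also have "\<dots> = of_real (LINT \<xi>|lborel. indicator {0..} \<xi> * (cmod (fourier p \<xi>))\<^sup>2)"
    by (rule Bochner_Integration.integral_complex_of_real)
  finally have 2: "Im (LINT x|lborel. q x * cnj (h x)) = 0"
    by (auto simp: complex_eq_iff)
  have "(LINT x|lborel. D x * cnj (h x)) - (LINT x|lborel. q x * cnj (h x)) = (LINT x|lborel. (D x - q x) * cnj (h x))"
    using L2_mult_integrable[OF D L2_cnj[OF h(1)]] L2_mult_integrable[OF q L2_cnj[OF h(1)]]
    by (subst Bochner_Integration.integral_diff[symmetric]) (auto simp: left_diff_distrib)
  also have "\<dots> = (LINT x|lborel. \<mu> * complex_of_real ((cmod (h x))\<^sup>2))"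
    using eig by (intro integral_cong_AE)
      (measurable, auto elim!: eventually_mono simp: complex_norm_square[unfolded of_real_power] lax_def D_def q_def p_def)
  also have "\<dots> = \<mu> * complex_of_real (LINT x|lborel. (cmod (h x))\<^sup>2)"
    by (simp only: integral_mult_right_zero Bochner_Integration.integral_complex_of_real)
  finally have "Im (\<mu> * complex_of_real (LINT x|lborel. (cmod (h x))\<^sup>2)) = 0"
    using 1 2 by (metis diff_self minus_complex.simps(2))
  then have "Im \<mu> * (LINT x|lborel. (cmod (h x))\<^sup>2) = 0"
    by simp
  moreover have "(LINT x|lborel. (cmod (h x))\<^sup>2) \<noteq> 0"
  proof
    assume "(LINT x|lborel. (cmod (h x))\<^sup>2) = 0"
    then have "sqnorm h = 0" using sqnorm_eq_integral[OF h(1)] by simp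
    then show False using nz by (simp add: sqnorm_0_iff)
  qed
  ultimately show ?thesis by simp
qed

text \<open>In the definition of \<open>Linf_weighted\<close> the weight is a power of complex numbers.\<close>

lemma Linf_weighted_iff:
  "f \<in> Linf_weighted r \<longleftrightarrow> f \<in> borel_measurable borel \<and>
    (\<exists>C. AE x in lborel. (1 + x\<^sup>2) powr (r / 2) * cmod (f x) \<le> C)"
proof -
  have "cmod ((1 + (complex_of_real x)\<^sup>2) powr (of_real r / 2)) = (1 + x\<^sup>2) powr (r / 2)" for x
  proof -
    have "(1 + (complex_of_real x)\<^sup>2) powr (of_real r / 2) = of_real ((1 + x\<^sup>2) powr (r / 2))"
      using powr_of_real[of "1 + x\<^sup>2" "r / 2"] by simp
    then show ?thesis by simp
  qed
  then show ?thesis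
    by (simp add: Linf_weighted_def norm_mult)
qed

text \<open>The bound on \<phi> reads |\<phi>|^2 \<le> C^2 (1 + x^2)^s, exactly the weight with
  which |u|^2 is integrable. Hence the projector acts on an \<open>L2\<close> function although
  \<phi> need not be in \<open>L2\<close>.\<close>

lemma Linf_weighted_mult_L2:
  assumes u: "u \<in> L2_weighted s" and \<phi>: "\<phi> \<in> Linf_weighted (- s)"
  shows "(\<lambda>x. cnj (u x) * \<phi> x) \<in> L2"
proof -
  obtain C where C: "AE x in lborel. (1 + x\<^sup>2) powr (- s / 2) * cmod (\<phi> x) \<le> C"
    using \<phi> unfolding Linf_weighted_iff by blast
  have [measurable]: "u \<in> borel_measurable borel" "\<phi> \<in> borel_measurable borel"
    using u \<phi> by (auto simp: L2_weighted_def Linf_weighted_iff)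
  have int: "integrable lborel (\<lambda>x. C\<^sup>2 * ((cmod (u x))\<^sup>2 * (1 + x\<^sup>2) powr s))"
    using u by (auto simp: L2_weighted_def)
  have "integrable lborel (\<lambda>x. (cmod (cnj (u x) * \<phi> x))\<^sup>2)"
  proof (rule Bochner_Integration.integrable_bound[OF int])
    show "AE x in lborel. norm ((cmod (cnj (u x) * \<phi> x))\<^sup>2) \<le> norm (C\<^sup>2 * ((cmod (u x))\<^sup>2 * (1 + x\<^sup>2) powr s))"
      using C
    proof eventually_elim
      case (elim x)
      have pos: "1 + x\<^sup>2 > 0" by (simp add: add_pos_nonneg)
      have "((1 + x\<^sup>2) powr (- s / 2) * cmod (\<phi> x))\<^sup>2 \<le> C\<^sup>2"
        using elim by (intro power_mono) (auto simp: norm_mult)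
      then have "((1 + x\<^sup>2) powr (- s / 2))\<^sup>2 * (cmod (\<phi> x))\<^sup>2 \<le> C\<^sup>2"
        by (simp add: power_mult_distrib)
      also have "((1 + x\<^sup>2) powr (- s / 2))\<^sup>2 = (1 + x\<^sup>2) powr (- s)"
        by (simp add: power2_eq_square flip: powr_add)
      finally have "(1 + x\<^sup>2) powr s * ((1 + x\<^sup>2) powr (- s) * (cmod (\<phi> x))\<^sup>2) \<le> (1 + x\<^sup>2) powr s * C\<^sup>2"
        by (intro mult_left_mono) auto
      moreover have "(1 + x\<^sup>2) powr s * (1 + x\<^sup>2) powr (- s) = 1"
        using pos by (simp flip: powr_add)
      ultimately have "(cmod (\<phi> x))\<^sup>2 \<le> (1 + x\<^sup>2) powr s * C\<^sup>2"
        by (simp flip: mult.assoc)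
      from mult_left_mono[OF this, of "(cmod (u x))\<^sup>2"]
      show ?case by (simp add: norm_mult power_mult_distrib abs_mult mult_ac)
    qed
  qed measurable
  then show ?thesis by (simp add: L2_def)
qed

section \<open>Solutions of the integral equation\<close>

lemma convolution_AE_zero:
  assumes "AE y in lborel. f y = 0" "f \<in> borel_measurable borel" "g \<in> borel_measurable borel"
  shows "Defs.convolution g f x = 0"
proof -
  have "Defs.convolution g f x = integral\<^sup>L lborel (\<lambda>y::real. 0)"
    unfolding Defs.convolution_def using assms
    by (intro integral_cong_AE) (measurable, auto elim: eventually_mono)
  then show ?thesis by simp
qed

lemma is_solution_1:
  assumes s: "s \<ge> 0" and u: "u \<in> H_plus \<sigma>"
    and d: "d > 0" "\<And>\<xi>. \<xi> \<ge> 0 \<Longrightarrow> d \<le> cmod (of_real \<xi> - k)"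
  shows "is_solution u s k (\<lambda>x. 1)"
proof -
  have uL2: "u \<in> L2" by (rule H_plus_D(1)[OF u])
  have G: "G k \<in> L2"
    unfolding G_def by (intro L2_inv_fourier resolvent_symbol_L2[OF d])
  have [measurable]: "u \<in> borel_measurable borel" "szego (\<lambda>x. cnj (u x)) \<in> borel_measurable borel"
      "G k \<in> borel_measurable borel"
    using uL2 G by (auto intro: L2_measurable L2_szego L2_cnj)
  have "AE y in lborel. u y * szego (\<lambda>x. cnj (u x)) y = 0"
    using szego_cnj_H_plus[OF u] by eventually_elim simp
  then have "Defs.convolution (G k) (\<lambda>y. u y * szego (\<lambda>x. cnj (u x)) y) x = 0" for x
    by (rule convolution_AE_zero) measurable
  \<comment> \<open>The weight is at most 1, which puts the constant 1 in the solution space with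
    bound 1.\<close>
  moreover have "(1 + x\<^sup>2) powr (- s / 2) \<le> 1" for x :: real
    using powr_mono[of "- s / 2" 0 "1 + x\<^sup>2"] s by (simp add: powr_def split: if_splits)
  ultimately show ?thesis
    by (auto simp: is_solution_def Linf_weighted_iff intro!: exI[of _ 1])
qed

text \<open>The difference from the constant solution is an eigenfunction of the Lax operator.\<close>

lemma is_solution_unique:
  assumes u: "u \<in> H_plus 1" "u \<in> L2_weighted s"
    and d: "d > 0" "\<And>\<xi>. \<xi> \<ge> 0 \<Longrightarrow> d \<le> cmod (of_real \<xi> - k)"
    and k: "k \<notin> sigma_pp u" and sol: "is_solution u s k \<phi>"
  shows "AE x in lborel. \<phi> x = 1"
proof -
  note uL2 = H_plus_D(1)[OF u(1)]
  obtain B where B: "AE x in lborel. cmod (u x) \<le> B"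
    using H_plus_1_bounded[OF u(1)] by blast
  define g where "g = (\<lambda>\<xi>. complex_of_real (indicator {0..} \<xi>) / (of_real \<xi> - k))"
  have g: "g \<in> L2" unfolding g_def by (rule resolvent_symbol_L2[OF d])
  have gB: "cmod (g \<xi>) \<le> 1 / d" for \<xi> unfolding g_def by (rule resolvent_symbol_bounded[OF d])
  have \<phi>: "\<phi> \<in> Linf_weighted (- s)" using sol by (simp add: is_solution_def)
  define \<psi> where "\<psi> = (\<lambda>x. cnj (u x) * \<phi> x)"
  have \<psi>: "\<psi> \<in> L2" unfolding \<psi>_def by (rule Linf_weighted_mult_L2[OF u(2) \<phi>])
  define v where "v = szego \<psi>"
  have v: "v \<in> L2" unfolding v_def by (rule L2_szego[OF \<psi>])
  define f where "f = (\<lambda>x. u x * v x)"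
  have f: "f \<in> L2"
    unfolding f_def using B uL2 by (intro L2_mult_bounded[OF v, of _ B]) (auto intro: L2_measurable)
  \<comment> \<open>Integrability allows the sign of the spectrum of f to be read off from the
    integral \<open>ft f\<close>.\<close>
  have int_f: "integrable lborel f"
    unfolding f_def by (rule L2_mult_integrable[OF uL2 v])
  define W where "W = (\<lambda>\<xi>. g \<xi> * fourier f \<xi>)"
  have Ff: "fourier f \<in> L2" by (rule L2_fourier[OF f])
  have W: "W \<in> L2"
    unfolding W_def using g by (intro L2_mult_bounded[OF Ff _ AE_I2[OF gB]]) (auto intro: L2_measurable)
  \<comment> \<open>w is built directly as an \<open>L2\<close> function and only afterwards
    identified with \<phi> - 1, about which just a weighted bound is known.\<close>
  define w where "w = inv_fourier W"
  have w: "w \<in> L2" unfolding w_def by (rule L2_inv_fourier[OF W])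
  have uw: "(\<lambda>x. cnj (u x) * w x) \<in> L2"
    using B uL2 by (intro L2_mult_bounded[OF w, of _ B]) (auto intro: L2_measurable L2_cnj)
  have [measurable]: "u \<in> borel_measurable borel" "\<phi> \<in> borel_measurable borel" "\<psi> \<in> borel_measurable borel"
      "w \<in> borel_measurable borel" "fourier w \<in> borel_measurable borel" "fourier f \<in> borel_measurable borel"
      "W \<in> borel_measurable borel" "fourier \<psi> \<in> borel_measurable borel"
      "fourier (\<lambda>x. cnj (u x) * w x) \<in> borel_measurable borel"
    using uL2 \<phi> \<psi> w f W uw by (auto intro: L2_measurable L2_fourier simp: Linf_weighted_def)

  have Fw: "AE \<xi> in lborel. fourier w \<xi> = W \<xi>"
    unfolding w_def by (rule fourier_inv_fourier[OF W])
  have Fv: "AE \<xi> in lborel. \<xi> < 0 \<longrightarrow> fourier v \<xi> = 0"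
    using fourier_szego[OF \<psi>] unfolding v_def by eventually_elim (simp add: indicator_def)
  have Ff0: "AE \<xi> in lborel. \<xi> < 0 \<longrightarrow> fourier f \<xi> = 0"
    using fourier_eq_ft[OF f int_f]
    by eventually_elim (simp add: f_def ft_mult_eq_0[OF uL2 H_plus_D(2)[OF u(1)] v Fv])
  have \<phi>w: "AE x in lborel. \<phi> x = 1 + w x"
  proof -
    have "AE x in lborel. \<phi> x = 1 + Defs.convolution (inv_fourier g) f x"
      using sol by (simp add: is_solution_def G_def g_def f_def v_def \<psi>_def)
    then show ?thesis
      using convolution_inv_fourier[OF g f gB] unfolding w_def W_def by eventually_elim simp
  qed

  \<comment> \<open>Almost everywhere cnj u * \<phi> = cnj u + cnj u * w, and the projector
    annihilates the first term. The choice in \<open>fourier\<close> ignores null sets, so this is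
    an equality of functions.\<close>
  have v_eq: "v = szego (\<lambda>x. cnj (u x) * w x)"
    unfolding v_def szego_def
  proof (rule inv_fourier_cong_AE)
    have "fourier \<psi> = fourier (\<lambda>x. cnj (u x) + cnj (u x) * w x)"
      using \<phi>w by (intro fourier_cong_AE) (auto elim!: eventually_mono simp: \<psi>_def distrib_left)
    then show "AE \<xi> in lborel. of_real (indicator {0..} \<xi>) * fourier \<psi> \<xi> =
        of_real (indicator {0..} \<xi>) * fourier (\<lambda>x. cnj (u x) * w x) \<xi>"
      using fourier_add[OF L2_cnj[OF uL2] uw] fourier_cnj_H_plus[OF u(1)]
      by (auto elim!: eventually_elim2 simp: distrib_left)
  qed measurable

  \<comment> \<open>For \<xi> \<ge> 0 this clears the denominator \<xi> - k; for \<xi> < 0 both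
    sides vanish because f has nonnegative spectrum.\<close>
  have xiW: "AE \<xi> in lborel. of_real \<xi> * fourier w \<xi> = k * W \<xi> + fourier f \<xi>"
    using Fw Ff0
  proof eventually_elim
    case (elim \<xi>)
    show ?case
    proof (cases "\<xi> \<ge> 0")
      case True
      then have "of_real \<xi> - k \<noteq> 0" using d(1) d(2)[OF True] by auto
      then show ?thesis using True elim by (simp add: W_def g_def field_simps)
    next
      case False
      then show ?thesis using elim by (simp add: W_def)
    qed
  qed
  have kWf: "(\<lambda>\<xi>. k * W \<xi> + fourier f \<xi>) \<in> L2"
    by (intro L2_add L2_cmult W Ff)
  have xi: "(\<lambda>\<xi>. of_real \<xi> * fourier w \<xi>) \<in> L2"
    by (rule L2_cong_AE[OF kWf]) (use xiW in \<open>auto elim: eventually_mono\<close>)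
  have "w \<in> H_plus 1"
  proof -
    have "(\<lambda>\<xi>. (1 + \<xi>\<^sup>2) powr 1 * (cmod (fourier w \<xi>))\<^sup>2) =
       (\<lambda>\<xi>. (cmod (fourier w \<xi>))\<^sup>2 + (cmod (of_real \<xi> * fourier w \<xi>))\<^sup>2)"
      by (auto simp: fun_eq_iff norm_mult power_mult_distrib algebra_simps add_nonneg_nonneg)
    moreover have "integrable lborel \<dots>"
      by (intro Bochner_Integration.integrable_add L2_integrable L2_fourier w xi)
    moreover have "AE \<xi> in lborel. \<xi> < 0 \<longrightarrow> fourier w \<xi> = 0"
      using Fw Ff0 by eventually_elim (auto simp: W_def)
    ultimately show ?thesis
      using w by (simp add: H_plus_def H_space_def ess_support_subset_atLeast_iff)
  qed
  moreover have "AE x in lborel. lax u w x = k * w x"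
  proof -
    have deriv: "deriv_L2 w = inv_fourier (\<lambda>\<xi>. \<i> * (k * W \<xi> + fourier f \<xi>))"
      unfolding deriv_L2_def mult.assoc
      using xiW by (intro inv_fourier_cong_AE) (auto elim: eventually_mono)
    show ?thesis
      using inv_fourier_cmult[OF kWf, of \<i>] inv_fourier_add[OF L2_cmult[OF W] Ff, of k]
        inv_fourier_cmult[OF W, of k] inv_fourier_fourier[OF f]
    proof eventually_elim
      case (elim x)
      then have "deriv_L2 w x = \<i> * (k * w x + f x)"
        unfolding deriv by (simp add: w_def)
      \<comment> \<open>By \<open>v_eq\<close>, f is also the potential term u \<Pi>(cnj u w), so it
        cancels the f in the derivative and leaves k w.\<close>
      moreover have "lax u w x = - \<i> * deriv_L2 w x - f x"
        unfolding lax_def f_def by (simp only: v_eq)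
      ultimately show ?case
        by (simp add: mult.assoc[symmetric])
    qed
  qed
  ultimately have "AE x in lborel. w x = 0"
    using k unfolding sigma_pp_def by blast
  then show ?thesis
    using \<phi>w by eventually_elim simp
qed

theorem proposition1p9:
  fixes u :: "real \<Rightarrow> complex" and s :: real
  assumes "s > 1 / 2"
    and "u \<in> H_plus 1 \<inter> L2_weighted s"
  shows "\<forall>k \<in> {z. Im z > 0} \<union> {z. Im z < 0} \<union> (complex_of_real ` {..<0} - sigma_pp u).
           is_solution u s k (\<lambda>x. 1) \<and>
           (\<forall>\<phi>. is_solution u s k \<phi> \<longrightarrow> (AE x in lborel. \<phi> x = 1))"
proof
  fix k assume k: "k \<in> {z. Im z > 0} \<union> {z. Im z < 0} \<union> (complex_of_real ` {..<0} - sigma_pp u)"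
  have u: "u \<in> H_plus 1" "u \<in> L2_weighted s" using assms by auto
  have "k \<notin> sigma_pp u"
    using k sigma_pp_real[OF u(1)] by force
  \<comment> \<open>A positive lower bound for the distance from k to [0, \<infinity>): -a when k =
    a < 0, and |Im k| off the real axis.\<close>
  moreover have "\<exists>d>0. \<forall>\<xi>\<ge>0. d \<le> cmod (of_real \<xi> - k)"
  proof (cases "Im k = 0")
    case True
    then obtain a where a: "a < 0" "k = of_real a" using k by auto
    have "- a \<le> cmod (of_real \<xi> - k)" if "\<xi> \<ge> 0" for \<xi>
    proof -
      have "cmod (of_real \<xi> - k) = \<bar>\<xi> - a\<bar>"
        unfolding a of_real_diff[symmetric] by (rule norm_of_real)
      then show ?thesis using that a by simp
    qed
    then show ?thesis using a by (intro exI[of _ "- a"]) auto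
  next
    case False
    have "\<bar>Im k\<bar> \<le> cmod (of_real \<xi> - k)" for \<xi>
      using abs_Im_le_cmod[of "of_real \<xi> - k"] by simp
    then show ?thesis using False by (intro exI[of _ "\<bar>Im k\<bar>"]) auto
  qed
  then obtain d where d: "d > 0" "\<And>\<xi>. \<xi> \<ge> 0 \<Longrightarrow> d \<le> cmod (of_real \<xi> - k)" by blast
  ultimately show "is_solution u s k (\<lambda>x. 1) \<and>
           (\<forall>\<phi>. is_solution u s k \<phi> \<longrightarrow> (AE x in lborel. \<phi> x = 1))"
    using is_solution_1[OF _ u(1) d] is_solution_unique[OF u d] assms(1) by auto
qed

end
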